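(* The statistics constants satisfy $\lambda(3,2)=8/9$, $\lambda(4,2)=264/343$ and $\lambda(4,4)=26/27$.
   Context: A $d$-subcube of $\{0,1\}^n$ is a set $C\subseteq\{0,1\}^n$ obtained by fixing $n-d$ coordinates to constant values and letting the remaining $d$ coordinates vary arbitrarily; there are $\binom nd 2^{n-d}$ of them. For integers $0\le s\le 2^d$ and $S\subseteq\{0,1\}^n$, let $\Lambda(S,d,s)$ be the number of $d$-subcubes $C$ with $|S\cap C|=s$, let $\Lambda(n,d,s)=\max\{\Lambda(S,d,s): S\subseteq\{0,1\}^n\}$ for $n\ge d$, and let the statistics constant be $\lambda(d,s)=\lim_{n\to\infty}\Lambda(n,d,s)/\big(\binom nd 2^{n-d}\big)$ (the limit exists since the ratio is non-increasing in $n$). *)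

theory Defs
  imports Complex_Main
begin

text \<open>Points of the hypercube \{0,1\}^n are encoded as subsets x of {..<n}
  (x = set of coordinates equal to 1).\<close>

definition cube :: "nat \<Rightarrow> nat set set" where
  "cube n = Pow {..<n}"

text \<open>A d-subcube: choose the set D of d free coordinates and the set a of
  fixed coordinates (among the remaining ones) that are set to 1.\<close>
definition subcubes :: "nat \<Rightarrow> nat \<Rightarrow> nat set set set" where
  "subcubes n d = {{x \<in> cube n. x - D = a} | D a.
      D \<subseteq> {..<n} \<and> card D = d \<and> a \<subseteq> {..<n} - D}"

definition Lambda_set :: "nat set set \<Rightarrow> nat \<Rightarrow> nat \<Rightarrow> nat \<Rightarrow> nat" where
  "Lambda_set S n d s = card {C \<in> subcubes n d. card (S \<inter> C) = s}"

definition Lambda :: "nat \<Rightarrow> nat \<Rightarrow> nat \<Rightarrow> nat" where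
  "Lambda n d s = Max {Lambda_set S n d s | S. S \<subseteq> cube n}"

text \<open>The normalized sequence whose limit is the statistics constant lambda(d,s).\<close>
definition Lambda_ratio :: "nat \<Rightarrow> nat \<Rightarrow> nat \<Rightarrow> real" where
  "Lambda_ratio d s n = real (Lambda n d s) / (real (n choose d) * 2 ^ (n - d))"

end

theory Submission
  imports Defs "HOL-Combinatorics.Multiset_Permutations" "HOL-Real_Asymp.Real_Asymp"
begin

text \<open>
  Lower bounds: give each coordinate a nonzero weight in \<open>F\<^sub>2\<^sup>k\<close>, each weight equally often, and let \<open>S\<close>
  consist of the points whose weights sum to zero. A \<open>d\<close>-subcube whose \<open>d\<close> weights span \<open>F\<^sub>2\<^sup>k\<close> meets \<open>S\<close> in
  exactly \<open>2\<^bsup>d-k\<^esup>\<close> points, and \<open>k = 2\<close> (for \<open>\<lambda>(3,2)\<close> and \<open>\<lambda>(4,4)\<close>) and \<open>k = 3\<close> (for \<open>\<lambda>(4,2)\<close>) give the claimed values.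

  Upper bounds: a flag algebra argument. For a fixed small face at a base point, a weight function of the
  way it continues in one further direction (for \<open>\<lambda>(4,4)\<close>, of the 2-face at the base point in two
  directions) has a nonnegative squared sum over all directions. Summing these squares over all faces
  and regrouping by \<open>d\<close>-subcubes reduces the bound to an inequality about the subsets of a single
  \<open>d\<close>-cube, which is a finite check; for \<open>d = 4\<close> it is done up to the symmetries of the cube.
\<close>

subsection \<open>Counting subcubes by base point and ordered directions\<close>

definition flip :: "nat \<Rightarrow> nat set \<Rightarrow> nat set" where
  "flip i v = (if i \<in> v then v - {i} else insert i v)"

lemma flip_flip [simp]: "flip i (flip i v) = v"
  by (auto simp: flip_def)

lemma flip_commute: "flip i (flip j v) = flip j (flip i v)"
  by (auto simp: flip_def)

lemma flip_in_cube: "i < n \<Longrightarrow> flip i v \<in> cube n \<longleftrightarrow> v \<in> cube n"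
  by (auto simp: flip_def cube_def)

lemma finite_cube [simp]: "finite (cube n)"
  by (simp add: cube_def)

lemma card_cube [simp]: "card (cube n) = 2 ^ n"
  by (simp add: cube_def card_Pow)

lemma sum_cube_flip:
  assumes "i < n"
  shows "(\<Sum>v\<in>cube n. h (flip i v)) = (\<Sum>v\<in>cube n. h v)"
  by (rule sum.reindex_bij_witness[of _ "flip i" "flip i"]) (auto simp: flip_in_cube assms)

definition tuples :: "nat \<Rightarrow> nat \<Rightarrow> nat list set" where
  "tuples n d = {xs. length xs = d \<and> set xs \<subseteq> {..<n}}"

definition dtuples :: "nat \<Rightarrow> nat \<Rightarrow> nat list set" where
  "dtuples n d = {xs \<in> tuples n d. distinct xs}"

lemma finite_tuples [simp]: "finite (tuples n d)"
  using finite_lists_length_eq[of "{..<n}" d] by (simp add: tuples_def conj_commute)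

lemma finite_dtuples [simp]: "finite (dtuples n d)"
  by (simp add: dtuples_def)

lemma card_tuples: "card (tuples n d) = n ^ d"
  using card_lists_length_eq[of "{..<n}" d] by (simp add: tuples_def conj_commute)

lemma sum_tuples_0: "(\<Sum>xs\<in>tuples n 0. g xs) = g []"
proof -
  have "tuples n 0 = {[]}" by (auto simp: tuples_def)
  then show ?thesis by simp
qed

lemma sum_tuples_Suc:
  "(\<Sum>xs\<in>tuples n (Suc d). g xs) = (\<Sum>i<n. \<Sum>xs\<in>tuples n d. g (i # xs))"
proof -
  have "(\<Sum>xs\<in>tuples n (Suc d). g xs) = (\<Sum>(i,xs)\<in>{..<n} \<times> tuples n d. g (i # xs))"
    by (rule sum.reindex_bij_witness[of _ "\<lambda>(i,xs). i # xs" "\<lambda>xs. (hd xs, tl xs)"])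
       (auto simp: tuples_def length_Suc_conv)
  then show ?thesis by (simp add: sum.cartesian_product)
qed

lemma sum_dtuples_set:
  fixes h :: "nat set \<Rightarrow> 'a::comm_semiring_1"
  shows "(\<Sum>xs\<in>dtuples n d. h (set xs)) = of_nat (fact d) * (\<Sum>D | D \<subseteq> {..<n} \<and> card D = d. h D)"
proof -
  let ?DD = "{D. D \<subseteq> {..<n} \<and> card D = d}"
  have im: "set ` dtuples n d \<subseteq> ?DD"
    by (auto simp: dtuples_def tuples_def distinct_card)
  have fib: "{xs \<in> dtuples n d. set xs = D} = permutations_of_set D" if "D \<in> ?DD" for D
    using that by (auto simp: dtuples_def tuples_def permutations_of_set_def distinct_card)
  have fin: "finite D" if "D \<in> ?DD" for D
    using that finite_subset by blast
  have "(\<Sum>xs\<in>dtuples n d. h (set xs)) = (\<Sum>D\<in>?DD. \<Sum>xs | xs \<in> dtuples n d \<and> set xs = D. h (set xs))"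
    using im by (subst sum.group) auto
  also have "\<dots> = (\<Sum>D\<in>?DD. of_nat (fact d) * h D)"
  proof (rule sum.cong[OF refl])
    fix D assume D: "D \<in> ?DD"
    have "(\<Sum>xs | xs \<in> dtuples n d \<and> set xs = D. h (set xs)) = (\<Sum>xs\<in>permutations_of_set D. h D)"
      using fib[OF D] by (intro sum.cong) auto
    then show "(\<Sum>xs | xs \<in> dtuples n d \<and> set xs = D. h (set xs)) = of_nat (fact d) * h D"
      using D fin[OF D] by (simp add: card_permutations_of_set)
  qed
  finally show ?thesis by (simp add: sum_distrib_left)
qed

lemma card_dtuples: "card (dtuples n d) = fact d * (n choose d)"
  using sum_dtuples_set[of "\<lambda>_. 1::nat" n d] by (simp add: n_subsets)

lemma sum_dtuples_permute:
  assumes "distinct ps" "set ps = {..<d}"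
  shows "(\<Sum>xs\<in>dtuples n d. h (map ((!) xs) ps)) = (\<Sum>xs\<in>dtuples n d. h xs)"
proof -
  let ?f = "\<lambda>xs. map ((!) xs) ps"
  have len: "length ps = d"
    using assms distinct_card by fastforce
  have inj: "inj_on ?f (dtuples n d)"
  proof (rule inj_onI)
    fix xs ys assume "xs \<in> dtuples n d" "ys \<in> dtuples n d" and eq: "?f xs = ?f ys"
    then have "length xs = d" "length ys = d" by (auto simp: dtuples_def tuples_def)
    moreover have "xs ! i = ys ! i" if "i < d" for i
      using eq that assms(2) by auto
    ultimately show "xs = ys" by (simp add: nth_equalityI)
  qed
  have into: "?f ` dtuples n d \<subseteq> dtuples n d"
  proof (rule image_subsetI)
    fix xs assume "xs \<in> dtuples n d"
    then have xs: "length xs = d" "set xs \<subseteq> {..<n}" "distinct xs" by (auto simp: dtuples_def tuples_def)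
    have "inj_on ((!) xs) (set ps)"
      using xs assms(2) by (auto simp: inj_on_def nth_eq_iff_index_eq)
    then have "distinct (?f xs)" using assms(1) by (simp add: distinct_map)
    moreover have "set (?f xs) \<subseteq> {..<n}"
    proof -
      have "xs ! i \<in> {..<n}" if "i < d" for i
        using xs that nth_mem by blast
      then show ?thesis using assms(2) by auto
    qed
    ultimately show "?f xs \<in> dtuples n d"
      using len by (simp add: dtuples_def tuples_def)
  qed
  have "?f ` dtuples n d = dtuples n d"
    using endo_inj_surj[OF finite_dtuples into inj] .
  then show ?thesis
    using sum.reindex[OF inj, of h] by simp
qed

text \<open>For distinct directions this is the size of the trace of \<open>S\<close> on the subcube
  through \<open>v\<close>: the recursion splits the subcube into two opposite facets.\<close>

primrec cnt :: "nat set set \<Rightarrow> nat set \<Rightarrow> nat list \<Rightarrow> nat" where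
  "cnt S v [] = (if v \<in> S then 1 else 0)"
| "cnt S v (i # xs) = cnt S v xs + cnt S (flip i v) xs"

lemma card_subcube_eq_cnt:
  assumes "distinct xs"
  shows "finite {x. x - set xs = v - set xs} \<and> card (S \<inter> {x. x - set xs = v - set xs}) = cnt S v xs"
  using assms
proof (induction xs arbitrary: v)
  case Nil
  show ?case by (cases "v \<in> S") (auto simp: insert_absorb)
next
  case (Cons i xs)
  let ?C = "\<lambda>v. {x. x - set xs = v - set xs}"
  have i: "i \<notin> set xs" and d: "distinct xs" using Cons.prems by auto
  have un: "{x. x - set (i # xs) = v - set (i # xs)} = ?C v \<union> ?C (flip i v)"
    using i by (auto simp: flip_def split: if_splits)
  have disj: "?C v \<inter> ?C (flip i v) = {}"
    using i by (auto simp: flip_def split: if_splits)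
  have "card (S \<inter> (?C v \<union> ?C (flip i v))) = card (S \<inter> ?C v) + card (S \<inter> ?C (flip i v))"
    unfolding Int_Un_distrib using disj Cons.IH[OF d] by (intro card_Un_disjoint) auto
  then show ?case using un Cons.IH[OF d] by simp
qed

lemma Lambda_set_eq_sum:
  "Lambda_set S n d s = (\<Sum>D | D \<subseteq> {..<n} \<and> card D = d. \<Sum>a\<in>Pow ({..<n} - D).
     of_bool (card (S \<inter> {x \<in> cube n. x - D = a}) = s))"
proof -
  let ?DD = "{D. D \<subseteq> {..<n} \<and> card D = d}"
  let ?P = "SIGMA D : ?DD. Pow ({..<n} - D)"
  let ?c = "\<lambda>(D,a). {x \<in> cube n. x - D = a}"
  \<comment> \<open>A subcube determines its parameters: \<open>a\<close> is its least point, and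
    the free directions are what its union adds to its intersection.\<close>
  have rec: "\<Inter> (?c (D,a)) = a \<and> \<Union> (?c (D,a)) - a = D" if "(D,a) \<in> ?P" for D a
  proof -
    have "a \<in> ?c (D,a)" "a \<union> D \<in> ?c (D,a)" using that by (auto simp: cube_def)
    moreover have "a \<subseteq> x \<and> x \<subseteq> a \<union> D" if "x \<in> ?c (D,a)" for x using that by auto
    moreover have "a \<inter> D = {}" using that by auto
    ultimately show ?thesis by blast
  qed
  have inj: "inj_on ?c ?P"
    unfolding inj_on_def using rec by (smt (verit, best) case_prodE prod.inject mem_Sigma_iff old.prod.exhaust)
  have sub: "subcubes n d = ?c ` ?P"
    unfolding subcubes_def by (auto simp: image_def)
  have fin: "finite ?P" by (intro finite_SigmaI) (auto intro: finite_subset)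
  have "{C \<in> subcubes n d. card (S \<inter> C) = s} = ?c ` {p \<in> ?P. card (S \<inter> ?c p) = s}"
    unfolding sub by blast
  then have "Lambda_set S n d s = card {p \<in> ?P. card (S \<inter> ?c p) = s}"
    unfolding Lambda_set_def using inj by (simp add: card_image inj_on_subset)
  also have "\<dots> = (\<Sum>p\<in>?P. of_bool (card (S \<inter> ?c p) = s))"
    using fin by (simp add: sum_of_bool_eq Int_def)
  also have "\<dots> = (\<Sum>(D,a)\<in>?P. of_bool (card (S \<inter> {x \<in> cube n. x - D = a}) = s))"
    by (simp only: case_prod_unfold)
  also have "\<dots> = (\<Sum>D\<in>?DD. \<Sum>a\<in>Pow ({..<n} - D). of_bool (card (S \<inter> {x \<in> cube n. x - D = a}) = s))"
    by (rule sum.Sigma[symmetric]) auto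
  finally show ?thesis .
qed

lemma sum_cube_Diff:
  fixes h :: "nat set \<Rightarrow> nat"
  assumes "D \<subseteq> {..<n}" "card D = d"
  shows "(\<Sum>v\<in>cube n. h (v - D)) = 2 ^ d * (\<Sum>a\<in>Pow ({..<n} - D). h a)"
proof -
  have fin: "finite D" using assms finite_subset by blast
  have "(\<Sum>v\<in>cube n. h (v - D)) = (\<Sum>(a,B)\<in>Pow ({..<n} - D) \<times> Pow D. h a)"
    by (rule sum.reindex_bij_witness[of _ "\<lambda>(a,B). a \<union> B" "\<lambda>v. (v - D, v \<inter> D)"])
       (use assms in \<open>auto simp: cube_def\<close>)
  also have "\<dots> = (\<Sum>a\<in>Pow ({..<n} - D). \<Sum>B\<in>Pow D. h a)"
    by (simp only: sum.cartesian_product)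
  finally show ?thesis using fin assms by (simp add: card_Pow sum_distrib_left)
qed

text \<open>Double counting: a \<open>d\<close>-subcube arises from each of its \<open>2^d\<close>
  points as base point and from each of the \<open>d!\<close> orders of its free directions.\<close>

lemma Lambda_set_eq_cnt:
  "2 ^ d * fact d * Lambda_set S n d s
     = (\<Sum>xs\<in>dtuples n d. \<Sum>v\<in>cube n. of_bool (cnt S v xs = s))"
proof -
  have *: "cnt S v xs = card (S \<inter> {x \<in> cube n. x - set xs = v - set xs})"
    if "xs \<in> dtuples n d" "v \<in> cube n" for v xs
  proof -
    have "{x. x - set xs = v - set xs} = {x \<in> cube n. x - set xs = v - set xs}"
      using that by (auto simp: dtuples_def tuples_def cube_def)
    then show ?thesis
      using card_subcube_eq_cnt[of xs v S] that by (simp add: dtuples_def)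
  qed
  have "(\<Sum>xs\<in>dtuples n d. \<Sum>v\<in>cube n. of_bool (cnt S v xs = s))
      = (\<Sum>xs\<in>dtuples n d. \<Sum>v\<in>cube n. of_bool (card (S \<inter> {x \<in> cube n. x - set xs = v - set xs}) = s) :: nat)"
    by (intro sum.cong refl) (simp add: *)
  also have "\<dots> = fact d * (\<Sum>D | D \<subseteq> {..<n} \<and> card D = d.
      \<Sum>v\<in>cube n. of_bool (card (S \<inter> {x \<in> cube n. x - D = v - D}) = s))"
    using sum_dtuples_set[of "\<lambda>D. \<Sum>v\<in>cube n. of_bool (card (S \<inter> {x \<in> cube n. x - D = v - D}) = s) :: nat" n d]
    by simp
  also have "\<dots> = fact d * (\<Sum>D | D \<subseteq> {..<n} \<and> card D = d.
      2 ^ d * (\<Sum>a\<in>Pow ({..<n} - D). of_bool (card (S \<inter> {x \<in> cube n. x - D = a}) = s)))"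
    by (rule arg_cong, rule sum.cong[OF refl], rule sum_cube_Diff) auto
  finally show ?thesis by (simp add: Lambda_set_eq_sum sum_distrib_left mult.assoc mult.left_commute)
qed

subsection \<open>Asymptotics\<close>

lemma card_dtuples_asymp:
  "(\<lambda>n. real (card (dtuples n d)) / real n ^ d) \<longlonglongrightarrow> 1"
proof -
  have lim: "(\<lambda>n. \<Prod>i<d. (real n - real i) / real n) \<longlonglongrightarrow> (\<Prod>i<d. 1)"
    by (intro tendsto_prod) real_asymp
  have "eventually (\<lambda>n. (\<Prod>i<d. (real n - real i) / real n) = real (card (dtuples n d)) / real n ^ d) sequentially"
    using eventually_ge_at_top[of d]
  proof eventually_elim
    case (elim n)
    have "real (card (dtuples n d)) = (\<Prod>i<d. real n - real i)"
      using elim gbinomial_prod_rev[of "real n" d]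
      by (simp add: card_dtuples binomial_gbinomial atLeast0LessThan)
    then show ?case by (simp add: prod_dividef)
  qed
  from Lim_transform_eventually[OF lim this] show ?thesis by simp
qed

lemma card_dtuples_pos: "d \<le> n \<Longrightarrow> card (dtuples n d) > 0"
  by (simp add: card_dtuples)

lemma tuples_excess_asymp:
  "(\<lambda>n. (real n ^ d - real (card (dtuples n d))) / real (card (dtuples n d))) \<longlonglongrightarrow> 0"
proof -
  have "(\<lambda>n. inverse (real (card (dtuples n d)) / real n ^ d) - 1) \<longlonglongrightarrow> inverse 1 - 1"
    by (intro tendsto_intros card_dtuples_asymp) simp
  moreover have "eventually (\<lambda>n. inverse (real (card (dtuples n d)) / real n ^ d) - 1
      = (real n ^ d - real (card (dtuples n d))) / real (card (dtuples n d))) sequentially"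
    using eventually_ge_at_top[of d]
  proof eventually_elim
    case (elim n)
    then have "real (card (dtuples n d)) \<noteq> 0" using card_dtuples_pos[OF elim] by linarith
    then show ?case by (simp add: diff_divide_distrib)
  qed
  ultimately show ?thesis
    using Lim_transform_eventually by fastforce
qed

lemma Lambda_attained: "\<exists>S\<subseteq>cube n. Lambda n d s = Lambda_set S n d s"
  and Lambda_set_le_Lambda: "S \<subseteq> cube n \<Longrightarrow> Lambda_set S n d s \<le> Lambda n d s"
proof -
  have eq: "{Lambda_set S n d s | S. S \<subseteq> cube n} = (\<lambda>S. Lambda_set S n d s) ` Pow (cube n)" by auto
  then have fin: "finite {Lambda_set S n d s | S. S \<subseteq> cube n}" by simp
  have "Lambda n d s \<in> {Lambda_set S n d s | S. S \<subseteq> cube n}"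
    unfolding Lambda_def by (rule Max_in[OF fin]) auto
  then show "\<exists>S\<subseteq>cube n. Lambda n d s = Lambda_set S n d s" by auto
  show "S \<subseteq> cube n \<Longrightarrow> Lambda_set S n d s \<le> Lambda n d s"
    unfolding Lambda_def using fin by (intro Max_ge) auto
qed

text \<open>Both bounds are normalised by the number \<open>2^n * card (dtuples n d)\<close> of base
  points with ordered directions. Lists with a repetition have vanishing proportion, so any constant
  \<open>K\<close> is good enough.\<close>

lemma Lambda_ratio_tendstoI:
  fixes t :: real and K :: real
  assumes upper: "\<And>n S. real (2 ^ d * fact d * Lambda_set S n d s)
      \<le> 2 ^ n * (t * card (dtuples n d) + K * (real n ^ d - card (dtuples n d)))"
    and lower: "\<And>n. S n \<subseteq> cube n" "\<And>n. real (2 ^ d * fact d * Lambda_set (S n) n d s) \<ge> 2 ^ n * L n"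
    and L: "(\<lambda>n. L n / card (dtuples n d)) \<longlonglongrightarrow> t"
  shows "Lambda_ratio d s \<longlonglongrightarrow> t"
proof (rule real_tendsto_sandwich[OF _ _ L])
  let ?D = "\<lambda>n. real (card (dtuples n d))"
  have ratio: "Lambda_ratio d s n = real (2 ^ d * fact d * Lambda n d s) / (2 ^ n * ?D n)" if "d \<le> n" for n
  proof -
    have "(2::real) ^ n = 2 ^ d * 2 ^ (n - d)" using that by (simp flip: power_add)
    then show ?thesis by (simp add: Lambda_ratio_def card_dtuples)
  qed
  have pos: "?D n > 0" if "d \<le> n" for n using card_dtuples_pos[OF that] by simp
  show "eventually (\<lambda>n. L n / ?D n \<le> Lambda_ratio d s n) sequentially"
    using eventually_ge_at_top[of d]
  proof eventually_elim
    case (elim n)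
    have "2 ^ n * L n \<le> real (2 ^ d * fact d * Lambda n d s)"
      using lower(2)[of n] Lambda_set_le_Lambda[OF lower(1), of n d s]
      by (smt (verit) mult_le_mono2 of_nat_le_iff)
    then have "2 ^ n * L n / (2 ^ n * ?D n) \<le> Lambda_ratio d s n"
      unfolding ratio[OF elim] by (intro divide_right_mono) auto
    then show ?case by simp
  qed
  show "eventually (\<lambda>n. Lambda_ratio d s n \<le> t + K * ((real n ^ d - ?D n) / ?D n)) sequentially"
    using eventually_ge_at_top[of d]
  proof eventually_elim
    case (elim n)
    obtain T where "T \<subseteq> cube n" "Lambda n d s = Lambda_set T n d s" using Lambda_attained by blast
    then have "Lambda_ratio d s n \<le> 2 ^ n * (t * ?D n + K * (real n ^ d - ?D n)) / (2 ^ n * ?D n)"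
      unfolding ratio[OF elim] using upper[of T n] by (intro divide_right_mono) auto
    also have "\<dots> = (t * ?D n + K * (real n ^ d - ?D n)) / ?D n" by simp
    also have "\<dots> = t + K * ((real n ^ d - ?D n) / ?D n)"
    proof -
      have "?D n \<noteq> 0" using pos[OF elim] by linarith
      then show ?thesis by (simp only: add_divide_distrib nonzero_mult_div_cancel_right times_divide_eq_right not_False_eq_True)
    qed
    finally show ?case .
  qed
  show "(\<lambda>n. t + K * ((real n ^ d - ?D n) / ?D n)) \<longlonglongrightarrow> t"
    using tendsto_add[OF tendsto_const tendsto_mult[OF tendsto_const tuples_excess_asymp[of d]], of t K] by simp
qed

text \<open>Here \<open>\<psi>\<close> is a sum of squares after summation over all tuples, and \<open>\<Psi>\<close> is its symmetrisation over
  the positions inside a subcube. Tuples with repeated entries contribute only a lower order term.\<close>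

lemma Lambda_set_upper:
  fixes \<psi> :: "nat set \<Rightarrow> nat list \<Rightarrow> int" and a b c K :: int
  assumes nonneg: "(\<Sum>xs\<in>tuples n d. \<Sum>v\<in>cube n. \<psi> v xs) \<ge> 0"
    and bound: "\<And>v xs. \<psi> v xs \<le> K"
    and sym: "(\<Sum>xs\<in>dtuples n d. \<Sum>v\<in>cube n. \<Psi> v xs) = m * (\<Sum>xs\<in>dtuples n d. \<Sum>v\<in>cube n. \<psi> v xs)"
    and loc: "\<And>v xs. xs \<in> dtuples n d \<Longrightarrow> \<Psi> v xs \<le> m * (a - b * of_bool (cnt S v xs = s))"
    and pos: "m > 0" "b > 0"
  shows "real (2 ^ d * fact d * Lambda_set S n d s)
      \<le> 2 ^ n * (real_of_int a / real_of_int b * card (dtuples n d) + real_of_int K / real_of_int b * (real n ^ d - card (dtuples n d)))"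
proof -
  let ?N = "int (2 ^ d * fact d * Lambda_set S n d s)"
  have N: "?N = (\<Sum>xs\<in>dtuples n d. \<Sum>v\<in>cube n. of_bool (cnt S v xs = s))"
    unfolding Lambda_set_eq_cnt by simp
  have "m * (\<Sum>xs\<in>dtuples n d. \<Sum>v\<in>cube n. \<psi> v xs)
      \<le> (\<Sum>xs\<in>dtuples n d. \<Sum>v\<in>cube n. m * (a - b * of_bool (cnt S v xs = s)))"
    unfolding sym[symmetric] by (intro sum_mono loc)
  also have "\<dots> = m * ((\<Sum>xs\<in>dtuples n d. \<Sum>v\<in>cube n. a) - b * ?N)"
    unfolding N by (simp only: sum_distrib_left sum_subtractf right_diff_distrib)
  finally have 1: "(\<Sum>xs\<in>dtuples n d. \<Sum>v\<in>cube n. \<psi> v xs) \<le> 2 ^ n * card (dtuples n d) * a - b * ?N"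
    using pos by (simp add: mult_ac)
  have sub: "dtuples n d \<subseteq> tuples n d" by (auto simp: dtuples_def)
  have cd: "int (card (tuples n d - dtuples n d)) = int n ^ d - card (dtuples n d)"
    using sub card_mono[OF finite_tuples sub] by (simp add: card_Diff_subset of_nat_diff card_tuples)
  have "(\<Sum>xs\<in>tuples n d - dtuples n d. \<Sum>v\<in>cube n. \<psi> v xs) \<le> (\<Sum>xs\<in>tuples n d - dtuples n d. \<Sum>v\<in>cube n. K)"
    by (intro sum_mono bound)
  also have "\<dots> = 2 ^ n * (int n ^ d - card (dtuples n d)) * K"
    using cd by simp
  \<comment> \<open>The nonnegative sum over all lists splits into the degenerate lists, at most
    \<open>K\<close> per term, and the distinct lists, bounded by the local inequality.\<close>
  finally have "0 \<le> 2 ^ n * (int n ^ d - card (dtuples n d)) * K + (2 ^ n * card (dtuples n d) * a - b * ?N)"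
    using nonneg 1 sum.subset_diff[OF sub, of "\<lambda>xs. \<Sum>v\<in>cube n. \<psi> v xs"] by simp
  then have "b * ?N \<le> 2 ^ n * (a * card (dtuples n d) + K * (int n ^ d - card (dtuples n d)))"
    by (simp add: algebra_simps)
  then have "real_of_int (b * ?N) \<le> real_of_int (2 ^ n * (a * card (dtuples n d) + K * (int n ^ d - card (dtuples n d))))"
    by (simp only: of_int_le_iff)
  then have "real_of_int b * real (2 ^ d * fact d * Lambda_set S n d s)
      \<le> 2 ^ n * (real_of_int a * card (dtuples n d) + real_of_int K * (real n ^ d - card (dtuples n d)))"
    by simp
  then show ?thesis using pos by (simp add: field_simps)
qed

subsection \<open>The extremal linear construction\<close>

definition parity :: "(nat \<Rightarrow> bool) \<Rightarrow> nat set \<Rightarrow> bool" where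
  "parity p x \<longleftrightarrow> odd (card {i \<in> x. p i})"

lemma parity_flip:
  assumes "finite x"
  shows "parity p (flip i x) \<longleftrightarrow> (parity p x \<noteq> p i)"
proof (cases "i \<in> x")
  case True
  have "{j \<in> flip i x. p j} = {j \<in> x. p j} - {i}" using True by (auto simp: flip_def)
  moreover have "card {j \<in> x. p j} > 0" if "p i" using True that assms by (auto simp: card_gt_0_iff)
  ultimately show ?thesis using True assms by (auto simp: parity_def card_Diff_singleton_if)
next
  case False
  have "{j \<in> flip i x. p j} = (if p i then insert i {j \<in> x. p j} else {j \<in> x. p j})"
    using False by (auto simp: flip_def)
  then show ?thesis using False assms by (auto simp: parity_def)
qed

text \<open>The number of subfamilies of a list of vectors in F_2^3 with sum \<open>s\<close>. F_2^2
  is embedded by a zero third coordinate, so one definition serves both values of k.\<close>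

primrec solutions :: "bool \<times> bool \<times> bool \<Rightarrow> (bool \<times> bool \<times> bool) list \<Rightarrow> nat" where
  "solutions s [] = (if s = (False, False, False) then 1 else 0)"
| "solutions s (w # ws) = solutions s ws +
     solutions (fst s \<noteq> fst w, fst (snd s) \<noteq> fst (snd w), snd (snd s) \<noteq> snd (snd w)) ws"

text \<open>In coding terms, \<open>w\<close> gives the columns of a parity check matrix and
  \<open>linear_set\<close> is the resulting linear code.\<close>

definition syndrome :: "(nat \<Rightarrow> bool \<times> bool \<times> bool) \<Rightarrow> nat set \<Rightarrow> bool \<times> bool \<times> bool" where
  "syndrome w x = (parity (fst \<circ> w) x, parity (fst \<circ> snd \<circ> w) x, parity (snd \<circ> snd \<circ> w) x)"

definition linear_set :: "(nat \<Rightarrow> bool \<times> bool \<times> bool) \<Rightarrow> nat \<Rightarrow> nat set set" where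
  "linear_set w n = {x \<in> cube n. syndrome w x = (False, False, False)}"

text \<open>Flipping a set of directions of \<open>v\<close> leads into the code exactly when the
  weights of these directions sum to the syndrome of \<open>v\<close>.\<close>

lemma cnt_linear_set:
  assumes "v \<in> cube n" "set xs \<subseteq> {..<n}"
  shows "cnt (linear_set w n) v xs = solutions (syndrome w v) (map w xs)"
  using assms
proof (induction xs arbitrary: v)
  case Nil
  then show ?case by (simp add: linear_set_def)
next
  case (Cons i xs)
  have fin: "finite v" using Cons.prems finite_subset by (auto simp: cube_def)
  have "flip i v \<in> cube n" using Cons.prems by (simp add: flip_in_cube)
  then show ?case using Cons fin by (simp add: parity_flip syndrome_def o_def)
qed

text \<open>Writing a coordinate as \<open>r + q * y\<close> with \<open>r < q\<close> and
  \<open>y < n div q\<close>, each pattern of residues is realised by at least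
  \<open>(n div q)^d\<close> lists.\<close>

lemma card_tuples_residues:
  assumes "q > 0" "R \<subseteq> tuples q d"
  shows "card {xs \<in> tuples n d. map (\<lambda>x. x mod q) xs \<in> R} \<ge> card R * (n div q) ^ d"
proof -
  let ?m = "n div q"
  let ?g = "\<lambda>(rs, ys). map2 (\<lambda>r y. r + q * y) rs ys"
  have mod: "map (\<lambda>x. x mod q) (?g (rs, ys)) = rs \<and> map (\<lambda>x. x div q) (?g (rs, ys)) = ys"
    if "rs \<in> tuples q d" "ys \<in> tuples ?m d" for rs ys
  proof -
    have len: "length rs = d" "length ys = d" using that by (auto simp: tuples_def)
    have "rs ! i < q" if "i < d" for i
      using \<open>rs \<in> tuples q d\<close> that nth_mem[of i rs] len unfolding tuples_def by blast
    then show ?thesis using len assms(1) by (auto intro!: nth_equalityI)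
  qed
  have inj: "inj_on ?g (R \<times> tuples ?m d)"
  proof (rule inj_on_inverseI[where g = "\<lambda>xs. (map (\<lambda>x. x mod q) xs, map (\<lambda>x. x div q) xs)"])
    fix p assume p: "p \<in> R \<times> tuples ?m d"
    then have "fst p \<in> tuples q d" "snd p \<in> tuples ?m d" using assms(2) by auto
    from mod[OF this] show "(map (\<lambda>x. x mod q) (?g p), map (\<lambda>x. x div q) (?g p)) = p"
      by (simp only: prod.collapse)
  qed
  have im: "?g ` (R \<times> tuples ?m d) \<subseteq> {xs \<in> tuples n d. map (\<lambda>x. x mod q) xs \<in> R}"
  proof (rule image_subsetI)
    fix p assume "p \<in> R \<times> tuples ?m d"
    then obtain rs ys where p: "p = (rs, ys)" and rs: "rs \<in> R" and ys: "ys \<in> tuples ?m d" by blast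
    have "r + q * y < n" if "r < q" "y < ?m" for r y
    proof -
      have "r + q * y < q * Suc y" using that by simp
      also have "\<dots> \<le> q * ?m" using that by (intro mult_le_mono) auto
      also have "\<dots> \<le> n" by simp
      finally show ?thesis .
    qed
    note lt = this
    have rs': "rs \<in> tuples q d" using rs assms(2) by blast
    have "set (?g (rs, ys)) \<subseteq> {..<n}"
    proof
      fix x assume "x \<in> set (?g (rs, ys))"
      then obtain r y where ry: "(r, y) \<in> set (zip rs ys)" and x: "x = r + q * y" by auto
      have "r \<in> set rs" "y \<in> set ys" using ry by (auto dest: set_zip_leftD set_zip_rightD)
      then have "r < q" "y < ?m" using rs' ys unfolding tuples_def by blast+
      then show "x \<in> {..<n}" unfolding x using lt by simp
    qed
    moreover have "length (?g (rs, ys)) = d" using rs' ys by (simp add: tuples_def)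
    ultimately have "?g (rs, ys) \<in> tuples n d" unfolding tuples_def by blast
    moreover have "map (\<lambda>x. x mod q) (?g (rs, ys)) \<in> R" using mod[OF rs' ys] rs by simp
    ultimately show "?g p \<in> {xs \<in> tuples n d. map (\<lambda>x. x mod q) xs \<in> R}" unfolding p by blast
  qed
  have "card R * ?m ^ d = card (?g ` (R \<times> tuples ?m d))"
    by (simp only: card_image[OF inj] card_cartesian_product card_tuples)
  also have "\<dots> \<le> card {xs \<in> tuples n d. map (\<lambda>x. x mod q) xs \<in> R}"
    by (rule card_mono[OF _ im]) simp
  finally show ?thesis .
qed

text \<open>A list with residues in \<open>R\<close> gives exactly \<open>s\<close> points from
  every base point. Those among them with repeated entries are discarded by subtracting the number
  of all degenerate lists.\<close>

lemma Lambda_set_linear_lower: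
  assumes "q > 0" and w: "\<And>i. w i = \<omega> (i mod q)" and R: "R \<subseteq> tuples q d"
    and sol: "\<And>rs v. rs \<in> R \<Longrightarrow> solutions (syndrome w v) (map \<omega> rs) = s"
  shows "real (2 ^ d * fact d * Lambda_set (linear_set w n) n d s)
    \<ge> 2 ^ n * (real (card R) * real (n div q) ^ d - (real n ^ d - card (dtuples n d)))"
proof -
  let ?G = "{xs \<in> tuples n d. map (\<lambda>x. x mod q) xs \<in> R}"
  have sub: "dtuples n d \<subseteq> tuples n d" by (auto simp: dtuples_def)
  have cd: "real (card (tuples n d - dtuples n d)) = real n ^ d - card (dtuples n d)"
    using sub card_mono[OF finite_tuples sub] by (simp add: card_Diff_subset of_nat_diff card_tuples)
  have "card R * (n div q) ^ d \<le> card ?G"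
    by (rule card_tuples_residues[OF assms(1) R])
  also have "\<dots> \<le> card (?G \<inter> dtuples n d) + card (tuples n d - dtuples n d)"
    by (subst card_Un_disjoint[symmetric]) (auto intro!: card_mono)
  finally have "real (card R) * real (n div q) ^ d
      \<le> real (card (?G \<inter> dtuples n d)) + real (card (tuples n d - dtuples n d))"
    by (simp flip: of_nat_power of_nat_mult of_nat_add)
  then have 1: "real (card R) * real (n div q) ^ d - (real n ^ d - card (dtuples n d))
      \<le> real (card (?G \<inter> dtuples n d))" unfolding cd by simp
  have hit: "cnt (linear_set w n) v xs = s" if "xs \<in> ?G \<inter> dtuples n d" "v \<in> cube n" for v xs
  proof -
    have "map w xs = map \<omega> (map (\<lambda>x. x mod q) xs)" by (simp add: w)
    moreover have "set xs \<subseteq> {..<n}" "map (\<lambda>x. x mod q) xs \<in> R" using that by (auto simp: tuples_def)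
    ultimately show ?thesis
      using that(2) cnt_linear_set[of v n xs w] sol by (simp only:)
  qed
  have "2 ^ n * card (?G \<inter> dtuples n d) = (\<Sum>xs\<in>?G \<inter> dtuples n d. \<Sum>v\<in>cube n. of_bool (cnt (linear_set w n) v xs = s))"
    using hit by simp
  also have "\<dots> \<le> (\<Sum>xs\<in>dtuples n d. \<Sum>v\<in>cube n. of_bool (cnt (linear_set w n) v xs = s))"
    by (intro sum_mono2) auto
  finally have "2 ^ n * card (?G \<inter> dtuples n d) \<le> 2 ^ d * fact d * Lambda_set (linear_set w n) n d s"
    unfolding Lambda_set_eq_cnt .
  then have "real (2 ^ n * card (?G \<inter> dtuples n d)) \<le> real (2 ^ d * fact d * Lambda_set (linear_set w n) n d s)"
    by (simp only: of_nat_le_iff)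
  moreover have "2 ^ n * (real (card R) * real (n div q) ^ d - (real n ^ d - card (dtuples n d)))
      \<le> 2 ^ n * real (card (?G \<inter> dtuples n d))"
    using 1 by (intro mult_left_mono) auto
  ultimately show ?thesis
    by (simp only: of_nat_mult of_nat_power of_nat_numeral order_trans)
qed

lemma linear_lower_asymp:
  assumes "q > 0"
  shows "(\<lambda>n. (real N * real (n div q) ^ d - (real n ^ d - card (dtuples n d))) / card (dtuples n d))
    \<longlonglongrightarrow> real N / real q ^ d"
proof -
  let ?D = "\<lambda>n. real (card (dtuples n d))"
  have fl: "(\<lambda>n. real (n div q) / real n) \<longlonglongrightarrow> inverse (real q)"
  proof (rule real_tendsto_sandwich)
    show "eventually (\<lambda>n. (real n / real q - 1) / real n \<le> real (n div q) / real n) sequentially"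
    proof (intro always_eventually allI divide_right_mono)
      fix n
      have "real n = real q * real (n div q) + real (n mod q)"
        by (simp flip: of_nat_mult of_nat_add)
      moreover have "real (n mod q) \<le> real q" using assms by (simp add: less_imp_le)
      ultimately show "real n / real q - 1 \<le> real (n div q)"
        using assms by (simp add: field_simps)
    qed simp
    show "eventually (\<lambda>n. real (n div q) / real n \<le> (real n / real q) / real n) sequentially"
      by (intro always_eventually allI divide_right_mono) (auto intro: of_nat_div_le_of_nat)
    show "(\<lambda>n. (real n / real q - 1) / real n) \<longlonglongrightarrow> inverse (real q)" using assms by real_asymp
    show "(\<lambda>n. (real n / real q) / real n) \<longlonglongrightarrow> inverse (real q)" using assms by real_asymp
  qed
  have "(\<lambda>n. real N * (real (n div q) / real n) ^ d / (?D n / real n ^ d) - (real n ^ d - ?D n) / ?D n)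
      \<longlonglongrightarrow> real N * inverse (real q) ^ d / 1 - 0"
    by (intro tendsto_intros fl card_dtuples_asymp tuples_excess_asymp) simp
  moreover have "eventually (\<lambda>n. real N * (real (n div q) / real n) ^ d / (?D n / real n ^ d) - (real n ^ d - ?D n) / ?D n
      = (real N * real (n div q) ^ d - (real n ^ d - ?D n)) / ?D n) sequentially"
    using eventually_gt_at_top[of 0]
    by eventually_elim (simp add: field_simps power_divide diff_divide_distrib)
  ultimately show ?thesis
    using Lim_transform_eventually by (fastforce simp: power_inverse divide_inverse)
qed

section \<open>Counting the spanning tuples of weights\<close>

definition digits :: "nat \<Rightarrow> bool \<times> bool \<times> bool" where
  "digits m = (odd m, odd (m div 2), odd (m div 4))"

lemma n_lists_map: "List.n_lists d (map f xs) = map (map f) (List.n_lists d xs)"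
  by (induction d) (simp_all add: map_concat o_def)

text \<open>The fibre sizes of the subset-sum map, indexed by its eight possible values; computing them
  incrementally makes counting the spanning tuples cheap.\<close>

definition hist where
  "hist ws = (solutions (False, False, False) ws, solutions (False, False, True) ws,
              solutions (False, True, False) ws, solutions (False, True, True) ws,
              solutions (True, False, False) ws, solutions (True, False, True) ws,
              solutions (True, True, False) ws, solutions (True, True, True) ws)"

text \<open>Adding a basis vector of F_2^3 to the index permutes the eight entries. Adding to a
  histogram its translate by a new weight is then the recursion of \<open>solutions\<close>.\<close>

fun shift1 where
  "shift1 True (x0, x1, x2, x3, x4, x5, x6, x7) = (x4, x5, x6, x7, x0, x1, x2, x3)"
| "shift1 False h = h"

fun shift2 where
  "shift2 True (x0, x1, x2, x3, x4, x5, x6, x7) = (x2, x3, x0, x1, x6, x7, x4, x5)"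
| "shift2 False h = h"

fun shift3 where
  "shift3 True (x0, x1, x2, x3, x4, x5, x6, x7) = (x1, x0, x3, x2, x5, x4, x7, x6)"
| "shift3 False h = h"

fun add8 where
  "add8 (x0, x1, x2, x3, x4, x5, x6, x7) (y0, y1, y2, y3, y4, y5, y6, y7)
    = (x0 + y0, x1 + y1, x2 + y2, x3 + y3, x4 + y4, x5 + y5, x6 + y6, x7 + y7 :: nat)"

fun hist_step where
  "hist_step (a, b, c) h = add8 h (shift1 a (shift2 b (shift3 c h)))"

lemma hist_Cons: "hist (w # ws) = hist_step w (hist ws)"
proof (cases w)
  case (fields a b c)
  then show ?thesis by (cases a; cases b; cases c) (simp_all add: hist_def Let_def)
qed

primrec hists where
  "hists 0 W = [(1, 0, 0, 0, 0, 0, 0, 0)]"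
| "hists (Suc d) W = concat (map (\<lambda>h. map (\<lambda>w. hist_step w h) W) (hists d W))"

lemma hists_eq: "hists d W = map hist (List.n_lists d W)"
proof (induction d)
  case 0
  show ?case by (simp add: hist_def)
next
  case (Suc d)
  then show ?case by (simp add: map_concat o_def hist_Cons)
qed

text \<open>One vector is only counted against the histograms of length \<open>d\<close>, so the
  evaluation never builds the largest level.\<close>

lemma card_hist:
  assumes W_def: "map \<omega> [0..<q] = W"
  shows "card {rs \<in> tuples q (Suc d). hist (map \<omega> rs) = h}
    = sum_list (map (\<lambda>h'. length (filter (\<lambda>w. hist_step w h' = h) W)) (hists d W))"
proof -
  let ?L = "filter (\<lambda>rs. hist (map \<omega> rs) = h) (List.n_lists (Suc d) [0..<q])"
  have "{rs \<in> tuples q (Suc d). hist (map \<omega> rs) = h} = set ?L"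
    by (auto simp: tuples_def set_n_lists simp del: n_lists.simps)
  then have "card {rs \<in> tuples q (Suc d). hist (map \<omega> rs) = h} = length ?L"
    by (simp only: distinct_card distinct_filter distinct_n_lists distinct_upt)
  also have "\<dots> = length (filter (\<lambda>h'. h' = h) (hists (Suc d) W))"
    by (simp only: hists_eq W_def[symmetric] n_lists_map filter_map o_def length_map)
  also have "\<dots> = sum_list (map (\<lambda>h'. length (filter (\<lambda>w. hist_step w h' = h) W)) (hists d W))"
    by (simp add: filter_concat length_concat filter_map o_def)
  finally show ?thesis .
qed

text \<open>The residue is shifted by one to skip the zero vector: the weights are the binary
  expansions of 1 to 3, and below of 1 to 7.\<close>

lemma digits_3: "map (\<lambda>r. digits (r + 1)) [0..<3] = [(True, False, False), (False, True, False), (True, True, False)]"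
  by (simp add: digits_def upt_rec)

lemma digits_7: "map (\<lambda>r. digits (r + 1)) [0..<7] = [(True, False, False), (False, True, False), (True, True, False),
    (False, False, True), (True, False, True), (False, True, True), (True, True, True)]"
  by (simp add: digits_def upt_rec)

text \<open>The tuples are those spanning F_2^2, for which all four fibres have equal size; the zero
  entries belong to vectors with nonzero third coordinate. Only the three constant triples fail,
  leaving 27 - 3; for length 4 below it is 81 - 3.\<close>

lemma spanning_count_3_2:
  "card {rs \<in> tuples 3 3. hist (map (\<lambda>r. digits (r + 1)) rs) = (2, 0, 2, 0, 2, 0, 2, 0)} = 24"
proof -
  let ?W = "[(True, False, False), (False, True, False), (True, True, False)]"
  have "sum_list (map (\<lambda>h. length (filter (\<lambda>w. hist_step w h = (2, 0, 2, 0, 2, 0, 2, 0)) ?W)) (hists 2 ?W)) = 24"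
    by code_simp
  then show ?thesis
    using card_hist[OF digits_3, of 2] by (simp only: Suc_numeral semiring_norm)
qed

lemma spanning_count_3_4:
  "card {rs \<in> tuples 3 4. hist (map (\<lambda>r. digits (r + 1)) rs) = (4, 0, 4, 0, 4, 0, 4, 0)} = 78"
proof -
  let ?W = "[(True, False, False), (False, True, False), (True, True, False)]"
  have "sum_list (map (\<lambda>h. length (filter (\<lambda>w. hist_step w h = (4, 0, 4, 0, 4, 0, 4, 0)) ?W)) (hists 3 ?W)) = 78"
    by code_simp
  then show ?thesis
    using card_hist[OF digits_3, of 3] by (simp only: Suc_numeral semiring_norm)
qed

text \<open>Of the 7^4 = 2401 tuples, 7 span a line and 7 * (3^4 - 3) = 546 span a plane.\<close>

lemma spanning_count_7_2:
  "card {rs \<in> tuples 7 4. hist (map (\<lambda>r. digits (r + 1)) rs) = (2, 2, 2, 2, 2, 2, 2, 2)} = 1848"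
proof -
  let ?W = "[(True, False, False), (False, True, False), (True, True, False),
      (False, False, True), (True, False, True), (False, True, True), (True, True, True)]"
  have "sum_list (map (\<lambda>h. length (filter (\<lambda>w. hist_step w h = (2, 2, 2, 2, 2, 2, 2, 2)) ?W)) (hists 3 ?W)) = 1848"
    by code_simp
  then show ?thesis
    using card_hist[OF digits_7, of 3] by (simp only: Suc_numeral semiring_norm)
qed

lemma Lambda_set_lower_3:
  assumes "card {rs \<in> tuples 3 d. hist (map (\<lambda>r. digits (r + 1)) rs) = (s, 0, s, 0, s, 0, s, 0)} = N"
  shows "real (2 ^ d * fact d * Lambda_set (linear_set (\<lambda>i. digits (i mod 3 + 1)) n) n d s)
    \<ge> 2 ^ n * (real N * real (n div 3) ^ d - (real n ^ d - card (dtuples n d)))"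
proof -
  \<comment> \<open>The weights 1 to 3 have zero third digit, hence so has every syndrome, and only
    histogram entries equal to \<open>s\<close> are consulted.\<close>
  have "odd ((i mod 3 + 1) div 4) = False" for i :: nat
    by (simp add: div_less)
  then have syn: "snd (snd (syndrome (\<lambda>i. digits (i mod 3 + 1)) v)) = False" for v
    by (simp add: syndrome_def digits_def parity_def o_def)
  have "solutions \<sigma> ws = s" if "hist ws = (s, 0, s, 0, s, 0, s, 0)" "snd (snd \<sigma>) = False" for \<sigma> ws
  proof (cases \<sigma>)
    case (fields a b c)
    then show ?thesis using that by (cases a; cases b) (simp_all add: hist_def)
  qed
  then show ?thesis
    using Lambda_set_linear_lower[of 3 "\<lambda>i. digits (i mod 3 + 1)" "\<lambda>r. digits (r + 1)"
        "{rs \<in> tuples 3 d. hist (map (\<lambda>r. digits (r + 1)) rs) = (s, 0, s, 0, s, 0, s, 0)}" d s n] syn assms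
    by auto
qed

lemma Lambda_set_lower_7:
  assumes "card {rs \<in> tuples 7 d. hist (map (\<lambda>r. digits (r + 1)) rs) = (s, s, s, s, s, s, s, s)} = N"
  shows "real (2 ^ d * fact d * Lambda_set (linear_set (\<lambda>i. digits (i mod 7 + 1)) n) n d s)
    \<ge> 2 ^ n * (real N * real (n div 7) ^ d - (real n ^ d - card (dtuples n d)))"
proof -
  have "solutions \<sigma> ws = s" if "hist ws = (s, s, s, s, s, s, s, s)" for \<sigma> ws
  proof (cases \<sigma>)
    case (fields a b c)
    then show ?thesis using that by (cases a; cases b; cases c) (simp_all add: hist_def)
  qed
  then show ?thesis
    using Lambda_set_linear_lower[of 7 "\<lambda>i. digits (i mod 7 + 1)" "\<lambda>r. digits (r + 1)"
        "{rs \<in> tuples 7 d. hist (map (\<lambda>r. digits (r + 1)) rs) = (s, s, s, s, s, s, s, s)}" d s n] assms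
    by auto
qed

subsection \<open>Checking a property of subsets of the 4-cube up to symmetry\<close>

fun lex_le :: "bool list \<Rightarrow> bool list \<Rightarrow> bool" where
  "lex_le (False # xs) (False # ys) = lex_le xs ys"
| "lex_le (True # xs) (True # ys) = lex_le xs ys"
| "lex_le (True # xs) (False # ys) = False"
| "lex_le _ _ = True"

text \<open>Reading a list as a binary number makes lexicographic descent a decreasing natural
  number, the measure of the induction in \<open>lex_check_complete\<close>.\<close>

primrec lex_val :: "bool list \<Rightarrow> nat" where
  "lex_val [] = 0"
| "lex_val (x # xs) = (if x then 2 ^ length xs else 0) + lex_val xs"

lemma lex_val_bound: "lex_val xs < 2 ^ length xs"
  by (induction xs) auto

lemma lex_val_less:
  assumes "length xs = length ys" "\<not> lex_le xs ys"
  shows "lex_val ys < lex_val xs"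
  using assms
proof (induction xs ys rule: list_induct2)
  case (Cons x xs y ys)
  then show ?case using lex_val_bound[of ys] by (cases x; cases y) auto
qed simp

text \<open>This makes the pruning sound: a symmetry preserving the lower half has to pass its test
  already there.\<close>

lemma lex_le_prefix:
  assumes "length xs = length ys" "lex_le (xs @ us) (ys @ vs)"
  shows "lex_le xs ys"
  using assms
proof (induction xs ys rule: list_induct2)
  case (Cons x xs y ys)
  then show ?case by (cases x; cases y) auto
qed simp

text \<open>The variable \<open>x\<close> followed by a hexadecimal digit says whether the vertex with these binary
  coordinates belongs to the subset. Only subsets that no single coordinate flip or adjacent transposition makes
  lexicographically smaller need to be tested; the conditions on the lower half come first so that
  they prune the search.\<close>

definition lex_check where
  "lex_check P \<longleftrightarrow> (\<forall>x0 x1 x2 x3 x4 x5 x6 x7.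
    if lex_le [x0, x1, x2, x3, x4, x5, x6, x7] [x1, x0, x3, x2, x5, x4, x7, x6] \<and>
      lex_le [x0, x1, x2, x3, x4, x5, x6, x7] [x2, x3, x0, x1, x6, x7, x4, x5] \<and>
      lex_le [x0, x1, x2, x3, x4, x5, x6, x7] [x4, x5, x6, x7, x0, x1, x2, x3] \<and>
      lex_le [x0, x1, x2, x3, x4, x5, x6, x7] [x0, x2, x1, x3, x4, x6, x5, x7] \<and>
      lex_le [x0, x1, x2, x3, x4, x5, x6, x7] [x0, x1, x4, x5, x2, x3, x6, x7]
    then \<forall>x8 x9 xa xb xc xd xe xf.
      if lex_le [x0, x1, x2, x3, x4, x5, x6, x7, x8, x9, xa, xb, xc, xd, xe, xf]
        [x1, x0, x3, x2, x5, x4, x7, x6, x9, x8, xb, xa, xd, xc, xf, xe] \<and>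
      lex_le [x0, x1, x2, x3, x4, x5, x6, x7, x8, x9, xa, xb, xc, xd, xe, xf]
        [x2, x3, x0, x1, x6, x7, x4, x5, xa, xb, x8, x9, xe, xf, xc, xd] \<and>
      lex_le [x0, x1, x2, x3, x4, x5, x6, x7, x8, x9, xa, xb, xc, xd, xe, xf]
        [x4, x5, x6, x7, x0, x1, x2, x3, xc, xd, xe, xf, x8, x9, xa, xb] \<and>
      lex_le [x0, x1, x2, x3, x4, x5, x6, x7, x8, x9, xa, xb, xc, xd, xe, xf]
        [x8, x9, xa, xb, xc, xd, xe, xf, x0, x1, x2, x3, x4, x5, x6, x7] \<and>
      lex_le [x0, x1, x2, x3, x4, x5, x6, x7, x8, x9, xa, xb, xc, xd, xe, xf]
        [x0, x2, x1, x3, x4, x6, x5, x7, x8, xa, x9, xb, xc, xe, xd, xf] \<and>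
      lex_le [x0, x1, x2, x3, x4, x5, x6, x7, x8, x9, xa, xb, xc, xd, xe, xf]
        [x0, x1, x4, x5, x2, x3, x6, x7, x8, x9, xc, xd, xa, xb, xe, xf] \<and>
      lex_le [x0, x1, x2, x3, x4, x5, x6, x7, x8, x9, xa, xb, xc, xd, xe, xf]
        [x0, x1, x2, x3, x8, x9, xa, xb, x4, x5, x6, x7, xc, xd, xe, xf]
      then P x0 x1 x2 x3 x4 x5 x6 x7 x8 x9 xa xb xc xd xe xf
      else True
    else True)"

text \<open>A lexicographically least counterexample passes all seven tests, since a symmetry that
  decreased it would yield a smaller counterexample.\<close>

lemma lex_check_complete:
  assumes "lex_check P"
    and "\<And>x0 x1 x2 x3 x4 x5 x6 x7 x8 x9 xa xb xc xd xe xf. P x1 x0 x3 x2 x5 x4 x7 x6 x9 x8 xb xa xd xc xf xe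
      \<Longrightarrow> P x0 x1 x2 x3 x4 x5 x6 x7 x8 x9 xa xb xc xd xe xf"
    and "\<And>x0 x1 x2 x3 x4 x5 x6 x7 x8 x9 xa xb xc xd xe xf. P x2 x3 x0 x1 x6 x7 x4 x5 xa xb x8 x9 xe xf xc xd
      \<Longrightarrow> P x0 x1 x2 x3 x4 x5 x6 x7 x8 x9 xa xb xc xd xe xf"
    and "\<And>x0 x1 x2 x3 x4 x5 x6 x7 x8 x9 xa xb xc xd xe xf. P x4 x5 x6 x7 x0 x1 x2 x3 xc xd xe xf x8 x9 xa xb
      \<Longrightarrow> P x0 x1 x2 x3 x4 x5 x6 x7 x8 x9 xa xb xc xd xe xf"
    and "\<And>x0 x1 x2 x3 x4 x5 x6 x7 x8 x9 xa xb xc xd xe xf. P x8 x9 xa xb xc xd xe xf x0 x1 x2 x3 x4 x5 x6 x7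
      \<Longrightarrow> P x0 x1 x2 x3 x4 x5 x6 x7 x8 x9 xa xb xc xd xe xf"
    and "\<And>x0 x1 x2 x3 x4 x5 x6 x7 x8 x9 xa xb xc xd xe xf. P x0 x2 x1 x3 x4 x6 x5 x7 x8 xa x9 xb xc xe xd xf
      \<Longrightarrow> P x0 x1 x2 x3 x4 x5 x6 x7 x8 x9 xa xb xc xd xe xf"
    and "\<And>x0 x1 x2 x3 x4 x5 x6 x7 x8 x9 xa xb xc xd xe xf. P x0 x1 x4 x5 x2 x3 x6 x7 x8 x9 xc xd xa xb xe xf
      \<Longrightarrow> P x0 x1 x2 x3 x4 x5 x6 x7 x8 x9 xa xb xc xd xe xf"
    and "\<And>x0 x1 x2 x3 x4 x5 x6 x7 x8 x9 xa xb xc xd xe xf. P x0 x1 x2 x3 x8 x9 xa xb x4 x5 x6 x7 xc xd xe xf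
      \<Longrightarrow> P x0 x1 x2 x3 x4 x5 x6 x7 x8 x9 xa xb xc xd xe xf"
  shows "P x0 x1 x2 x3 x4 x5 x6 x7 x8 x9 xa xb xc xd xe xf"
proof (rule ccontr)
  assume "\<not> P x0 x1 x2 x3 x4 x5 x6 x7 x8 x9 xa xb xc xd xe xf"
  then show False
  proof (induction "lex_val [x0, x1, x2, x3, x4, x5, x6, x7, x8, x9, xa, xb, xc, xd, xe, xf]" arbitrary: x0 x1 x2 x3 x4 x5 x6 x7 x8 x9 xa xb xc xd xe xf rule: less_induct)
    case less
    let ?F = "[x0, x1, x2, x3, x4, x5, x6, x7, x8, x9, xa, xb, xc, xd, xe, xf]"
    have flip0: "lex_le ?F [x1, x0, x3, x2, x5, x4, x7, x6, x9, x8, xb, xa, xd, xc, xf, xe]"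
    proof (rule ccontr)
      assume "\<not> lex_le ?F [x1, x0, x3, x2, x5, x4, x7, x6, x9, x8, xb, xa, xd, xc, xf, xe]"
      then have "lex_val [x1, x0, x3, x2, x5, x4, x7, x6, x9, x8, xb, xa, xd, xc, xf, xe] < lex_val ?F"
        by (intro lex_val_less) simp_all
      from less.hyps[OF this] have "P x1 x0 x3 x2 x5 x4 x7 x6 x9 x8 xb xa xd xc xf xe" by (rule ccontr)
      from assms(2)[OF this] show False using less.prems by contradiction
    qed
    have flip1: "lex_le ?F [x2, x3, x0, x1, x6, x7, x4, x5, xa, xb, x8, x9, xe, xf, xc, xd]"
    proof (rule ccontr)
      assume "\<not> lex_le ?F [x2, x3, x0, x1, x6, x7, x4, x5, xa, xb, x8, x9, xe, xf, xc, xd]"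
      then have "lex_val [x2, x3, x0, x1, x6, x7, x4, x5, xa, xb, x8, x9, xe, xf, xc, xd] < lex_val ?F"
        by (intro lex_val_less) simp_all
      from less.hyps[OF this] have "P x2 x3 x0 x1 x6 x7 x4 x5 xa xb x8 x9 xe xf xc xd" by (rule ccontr)
      from assms(3)[OF this] show False using less.prems by contradiction
    qed
    have flip2: "lex_le ?F [x4, x5, x6, x7, x0, x1, x2, x3, xc, xd, xe, xf, x8, x9, xa, xb]"
    proof (rule ccontr)
      assume "\<not> lex_le ?F [x4, x5, x6, x7, x0, x1, x2, x3, xc, xd, xe, xf, x8, x9, xa, xb]"
      then have "lex_val [x4, x5, x6, x7, x0, x1, x2, x3, xc, xd, xe, xf, x8, x9, xa, xb] < lex_val ?F"
        by (intro lex_val_less) simp_all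
      from less.hyps[OF this] have "P x4 x5 x6 x7 x0 x1 x2 x3 xc xd xe xf x8 x9 xa xb" by (rule ccontr)
      from assms(4)[OF this] show False using less.prems by contradiction
    qed
    have flip3: "lex_le ?F [x8, x9, xa, xb, xc, xd, xe, xf, x0, x1, x2, x3, x4, x5, x6, x7]"
    proof (rule ccontr)
      assume "\<not> lex_le ?F [x8, x9, xa, xb, xc, xd, xe, xf, x0, x1, x2, x3, x4, x5, x6, x7]"
      then have "lex_val [x8, x9, xa, xb, xc, xd, xe, xf, x0, x1, x2, x3, x4, x5, x6, x7] < lex_val ?F"
        by (intro lex_val_less) simp_all
      from less.hyps[OF this] have "P x8 x9 xa xb xc xd xe xf x0 x1 x2 x3 x4 x5 x6 x7" by (rule ccontr)
      from assms(5)[OF this] show False using less.prems by contradiction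
    qed
    have swap01: "lex_le ?F [x0, x2, x1, x3, x4, x6, x5, x7, x8, xa, x9, xb, xc, xe, xd, xf]"
    proof (rule ccontr)
      assume "\<not> lex_le ?F [x0, x2, x1, x3, x4, x6, x5, x7, x8, xa, x9, xb, xc, xe, xd, xf]"
      then have "lex_val [x0, x2, x1, x3, x4, x6, x5, x7, x8, xa, x9, xb, xc, xe, xd, xf] < lex_val ?F"
        by (intro lex_val_less) simp_all
      from less.hyps[OF this] have "P x0 x2 x1 x3 x4 x6 x5 x7 x8 xa x9 xb xc xe xd xf" by (rule ccontr)
      from assms(6)[OF this] show False using less.prems by contradiction
    qed
    have swap12: "lex_le ?F [x0, x1, x4, x5, x2, x3, x6, x7, x8, x9, xc, xd, xa, xb, xe, xf]"
    proof (rule ccontr)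
      assume "\<not> lex_le ?F [x0, x1, x4, x5, x2, x3, x6, x7, x8, x9, xc, xd, xa, xb, xe, xf]"
      then have "lex_val [x0, x1, x4, x5, x2, x3, x6, x7, x8, x9, xc, xd, xa, xb, xe, xf] < lex_val ?F"
        by (intro lex_val_less) simp_all
      from less.hyps[OF this] have "P x0 x1 x4 x5 x2 x3 x6 x7 x8 x9 xc xd xa xb xe xf" by (rule ccontr)
      from assms(7)[OF this] show False using less.prems by contradiction
    qed
    have swap23: "lex_le ?F [x0, x1, x2, x3, x8, x9, xa, xb, x4, x5, x6, x7, xc, xd, xe, xf]"
    proof (rule ccontr)
      assume "\<not> lex_le ?F [x0, x1, x2, x3, x8, x9, xa, xb, x4, x5, x6, x7, xc, xd, xe, xf]"
      then have "lex_val [x0, x1, x2, x3, x8, x9, xa, xb, x4, x5, x6, x7, xc, xd, xe, xf] < lex_val ?F"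
        by (intro lex_val_less) simp_all
      from less.hyps[OF this] have "P x0 x1 x2 x3 x8 x9 xa xb x4 x5 x6 x7 xc xd xe xf" by (rule ccontr)
      from assms(8)[OF this] show False using less.prems by contradiction
    qed
    \<comment> \<open>\<open>flip3\<close> and \<open>swap23\<close> move vertices across the two
      halves, so they give no test on the lower half alone.\<close>
    note le8 = lex_le_prefix[of "[x0, x1, x2, x3, x4, x5, x6, x7]" "[a, b, c, d, e, f, g, h]"
        "[x8, x9, xa, xb, xc, xd, xe, xf]" "[a', b', c', d', e', f', g', h']" for a b c d e f g h a' b' c' d' e' f' g' h', simplified]
    have "P x0 x1 x2 x3 x4 x5 x6 x7 x8 x9 xa xb xc xd xe xf"
      using assms(1)[unfolded lex_check_def, rule_format, of x0 x1 x2 x3 x4 x5 x6 x7]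
        le8[OF flip0] le8[OF flip1] le8[OF flip2] le8[OF swap01] le8[OF swap12]
        flip0 flip1 flip2 flip3 swap01 swap12 swap23
      by (simp only: if_True simp_thms)
    then show False using less.prems by simp
  qed
qed

definition size16 :: "bool \<Rightarrow> bool \<Rightarrow> bool \<Rightarrow> bool \<Rightarrow> bool \<Rightarrow> bool \<Rightarrow> bool \<Rightarrow> bool \<Rightarrow>
    bool \<Rightarrow> bool \<Rightarrow> bool \<Rightarrow> bool \<Rightarrow> bool \<Rightarrow> bool \<Rightarrow> bool \<Rightarrow> bool \<Rightarrow> nat" where
  "size16 x0 x1 x2 x3 x4 x5 x6 x7 x8 x9 xa xb xc xd xe xf
    = of_bool x0 + of_bool x1 + of_bool x2 + of_bool x3
      + of_bool x4 + of_bool x5 + of_bool x6 + of_bool x7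
      + of_bool x8 + of_bool x9 + of_bool xa + of_bool xb
      + of_bool xc + of_bool xd + of_bool xe + of_bool xf"

lemma size16_symmetric:
  "size16 x1 x0 x3 x2 x5 x4 x7 x6 x9 x8 xb xa xd xc xf xe = size16 x0 x1 x2 x3 x4 x5 x6 x7 x8 x9 xa xb xc xd xe xf"
  "size16 x2 x3 x0 x1 x6 x7 x4 x5 xa xb x8 x9 xe xf xc xd = size16 x0 x1 x2 x3 x4 x5 x6 x7 x8 x9 xa xb xc xd xe xf"
  "size16 x4 x5 x6 x7 x0 x1 x2 x3 xc xd xe xf x8 x9 xa xb = size16 x0 x1 x2 x3 x4 x5 x6 x7 x8 x9 xa xb xc xd xe xf"
  "size16 x8 x9 xa xb xc xd xe xf x0 x1 x2 x3 x4 x5 x6 x7 = size16 x0 x1 x2 x3 x4 x5 x6 x7 x8 x9 xa xb xc xd xe xf"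
  "size16 x0 x2 x1 x3 x4 x6 x5 x7 x8 xa x9 xb xc xe xd xf = size16 x0 x1 x2 x3 x4 x5 x6 x7 x8 x9 xa xb xc xd xe xf"
  "size16 x0 x1 x4 x5 x2 x3 x6 x7 x8 x9 xc xd xa xb xe xf = size16 x0 x1 x2 x3 x4 x5 x6 x7 x8 x9 xa xb xc xd xe xf"
  "size16 x0 x1 x2 x3 x8 x9 xa xb x4 x5 x6 x7 xc xd xe xf = size16 x0 x1 x2 x3 x4 x5 x6 x7 x8 x9 xa xb xc xd xe xf"
  by (simp_all only: size16_def ac_simps)

subsection \<open>The certificate for \<open>\<lambda>(4,2)\<close>\<close>

text \<open>A 2-face has the vertices 0, 1, 2, 3 in binary; \<open>Pm\<close> is the single vertex \<open>m\<close>, and \<open>Q03\<close>, \<open>Q12\<close>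
  are the two diagonals.\<close>

datatype face = Empty | P0 | P1 | P2 | P3 | Q03 | Q12 | Other

text \<open>\<open>Other\<close> collects the traces with two adjacent vertices. They do not occur
  in the extremal construction, where all weights are nonzero.\<close>

fun face_type :: "bool \<Rightarrow> bool \<Rightarrow> bool \<Rightarrow> bool \<Rightarrow> face" where
  "face_type False False False False = Empty"
| "face_type True False False False = P0"
| "face_type False True False False = P1"
| "face_type False False True False = P2"
| "face_type False False False True = P3"
| "face_type True False False True = Q03"
| "face_type False True True False = Q12"
| "face_type _ _ _ _ = Other"

text \<open>\<open>translate1\<close>, \<open>translate2\<close> and \<open>reflect\<close> are the
  actions on traces of flipping either direction of the face and of swapping both; they generate the
  symmetries of the square.\<close>

fun translate1 :: "face \<Rightarrow> face" where
  "translate1 P0 = P1" | "translate1 P1 = P0" | "translate1 P2 = P3" | "translate1 P3 = P2"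
| "translate1 Q03 = Q12" | "translate1 Q12 = Q03" | "translate1 a = a"

fun translate2 :: "face \<Rightarrow> face" where
  "translate2 P0 = P2" | "translate2 P2 = P0" | "translate2 P1 = P3" | "translate2 P3 = P1"
| "translate2 Q03 = Q12" | "translate2 Q12 = Q03" | "translate2 a = a"

fun reflect :: "face \<Rightarrow> face" where
  "reflect P1 = P2" | "reflect P2 = P1" | "reflect a = a"

lemma face_type_symmetric:
  "face_type b a d c = translate1 (face_type a b c d)"
  "face_type c d a b = translate2 (face_type a b c d)"
  "face_type a c b d = reflect (face_type a b c d)"
  by (cases a; cases b; cases c; cases d; simp)+

text \<open>For a 2-face with a given trace of \<open>S\<close>, these weights of the trace on a parallel neighbouring face have mean
  zero in the extremal construction. The coefficients below are chosen so that the local inequality is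
  an equality on the configurations which that construction contains. Weights of traces that it does not
  contain, such as \<open>P0\<close> in \<open>mass1\<close>, only have to satisfy inequalities.\<close>

fun mass0 :: "face \<Rightarrow> int" where
  "mass0 Empty = 4" | "mass0 Q03 = - 10" | "mass0 Q12 = - 10" | "mass0 Other = 0" | "mass0 _ = - 3"

fun diag03 :: "face \<Rightarrow> int" where
  "diag03 P0 = 1" | "diag03 P3 = - 1" | "diag03 _ = 0"

fun diag12 :: "face \<Rightarrow> int" where
  "diag12 P1 = 1" | "diag12 P2 = - 1" | "diag12 _ = 0"

fun sign1 :: "face \<Rightarrow> int" where
  "sign1 P0 = 1" | "sign1 P3 = 1" | "sign1 P1 = - 1" | "sign1 P2 = - 1" | "sign1 _ = 0"

fun sign2 :: "face \<Rightarrow> int" where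
  "sign2 Q03 = 1" | "sign2 Q12 = - 1" | "sign2 _ = 0"

fun mass1 :: "face \<Rightarrow> int" where
  "mass1 Empty = 3" | "mass1 P0 = - 5" | "mass1 P1 = - 4" | "mass1 P2 = - 4" | "mass1 P3 = - 4" | "mass1 _ = 0"

fun mass2 :: "face \<Rightarrow> int" where
  "mass2 Empty = 1" | "mass2 Q03 = - 6" | "mass2 _ = 0"

text \<open>A combination of rank-one forms with positive coefficients is positive semidefinite. The
  three forms serve a base face that is empty, has the single point 0, or has the diagonal
  \<open>Q12\<close>.\<close>

definition T42_0 :: "face \<Rightarrow> face \<Rightarrow> int" where
  "T42_0 a b = 1782 * (mass0 a * mass0 b) + 73038 * (diag03 a * diag03 b) + 73038 * (diag12 a * diag12 b)
    + 23205 * (sign1 a * sign1 b) + 134288 * (sign2 a * sign2 b)"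

definition T42_1 :: "face \<Rightarrow> face \<Rightarrow> int" where
  "T42_1 a b = 1859 * (mass1 a * mass1 b) + 65296 * (diag12 a * diag12 b)"

definition T42_2 :: "face \<Rightarrow> face \<Rightarrow> int" where
  "T42_2 a b = 792 * (mass2 a * mass2 b)"

text \<open>Every other base face is translated to one of the three representatives, which makes
  \<open>T42\<close> invariant under the symmetries of the square.\<close>

fun T42 :: "face \<Rightarrow> face \<Rightarrow> face \<Rightarrow> int" where
  "T42 Empty a b = T42_0 a b"
| "T42 P0 a b = T42_1 a b"
| "T42 P1 a b = T42_1 (translate1 a) (translate1 b)"
| "T42 P2 a b = T42_1 (translate2 a) (translate2 b)"
| "T42 P3 a b = T42_1 (translate1 (translate2 a)) (translate1 (translate2 b))"
| "T42 Q12 a b = T42_2 a b"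
| "T42 Q03 a b = T42_2 (translate1 a) (translate1 b)"
| "T42 Other a b = 0"

lemma T42_symmetric:
  "T42 p b a = T42 p a b"
  "T42 (translate1 p) (translate1 a) (translate1 b) = T42 p a b"
  "T42 (translate2 p) (translate2 a) (translate2 b) = T42 p a b"
  "T42 (reflect p) (reflect a) (reflect b) = T42 p a b"
  by (cases p; cases a; cases b; simp add: T42_0_def T42_1_def T42_2_def)+

text \<open>The value 1782 * 10^2 + 134288 is attained by two neighbours \<open>Q03\<close> of an
  empty face.\<close>

lemma T42_le: "T42 p a b \<le> 312488"
  by (cases p; cases a; cases b; simp add: T42_0_def T42_1_def T42_2_def)

lemma sum_sum_product_nonneg:
  fixes \<phi> :: "'a \<Rightarrow> int"
  shows "(\<Sum>k\<in>I. \<phi> k * (\<Sum>l\<in>I. \<phi> l)) \<ge> 0"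
  by (simp flip: sum_distrib_right)

text \<open>With the base face fixed, each rank-one form sums to the square of a single sum over
  \<open>I\<close>.\<close>

lemma T42_sum_nonneg: "(\<Sum>k\<in>I. \<Sum>l\<in>I. T42 p (a k) (a l)) \<ge> 0"
  by (cases p) (simp_all add: T42_0_def T42_1_def T42_2_def sum.distrib sum_sum_product_nonneg
      flip: sum_distrib_left)

text \<open>The arguments are four parallel 2-faces of a 4-cube, \<open>c\<close> being opposite to
  \<open>p\<close>; each serves once as base.\<close>

definition T42_sum :: "face \<Rightarrow> face \<Rightarrow> face \<Rightarrow> face \<Rightarrow> int" where
  "T42_sum p a b c = T42 p a b + T42 a p c + T42 b c p + T42 c b a"

lemma T42_sum_symmetric:
  "T42_sum a p c b = T42_sum p a b c"
  "T42_sum b c p a = T42_sum p a b c"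
  "T42_sum p b a c = T42_sum p a b c"
  "T42_sum (translate1 p) (translate1 a) (translate1 b) (translate1 c) = T42_sum p a b c"
  "T42_sum (translate2 p) (translate2 a) (translate2 b) (translate2 c) = T42_sum p a b c"
  "T42_sum (reflect p) (reflect a) (reflect b) (reflect c) = T42_sum p a b c"
  unfolding T42_sum_def using T42_symmetric(1) by (simp_all add: T42_symmetric(2-4))

lemma T42_sum_face_type:
  "T42_sum (face_type p1 p0 p3 p2) (face_type a1 a0 a3 a2) (face_type b1 b0 b3 b2) (face_type c1 c0 c3 c2)
    = T42_sum (face_type p0 p1 p2 p3) (face_type a0 a1 a2 a3) (face_type b0 b1 b2 b3) (face_type c0 c1 c2 c3)"
  "T42_sum (face_type p2 p3 p0 p1) (face_type a2 a3 a0 a1) (face_type b2 b3 b0 b1) (face_type c2 c3 c0 c1)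
    = T42_sum (face_type p0 p1 p2 p3) (face_type a0 a1 a2 a3) (face_type b0 b1 b2 b3) (face_type c0 c1 c2 c3)"
  "T42_sum (face_type p0 p2 p1 p3) (face_type a0 a2 a1 a3) (face_type b0 b2 b1 b3) (face_type c0 c2 c1 c3)
    = T42_sum (face_type p0 p1 p2 p3) (face_type a0 a1 a2 a3) (face_type b0 b1 b2 b3) (face_type c0 c1 c2 c3)"
    apply (subst (1 2 3 4) face_type_symmetric(1), rule T42_sum_symmetric)
   apply (subst (1 2 3 4) face_type_symmetric(2), rule T42_sum_symmetric)
  apply (subst (1 2 3 4) face_type_symmetric(3), rule T42_sum_symmetric)
  done

text \<open>There is one summand for each pair of face directions, so all 24 two-dimensional faces
  of the 4-cube serve as base.\<close>

definition loc42 where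
  "loc42 x0 x1 x2 x3 x4 x5 x6 x7 x8 x9 xa xb xc xd xe xf =
      T42_sum (face_type x0 x1 x2 x3) (face_type x4 x5 x6 x7)
        (face_type x8 x9 xa xb) (face_type xc xd xe xf)
    + T42_sum (face_type x0 x1 x4 x5) (face_type x2 x3 x6 x7)
        (face_type x8 x9 xc xd) (face_type xa xb xe xf)
    + T42_sum (face_type x0 x1 x8 x9) (face_type x2 x3 xa xb)
        (face_type x4 x5 xc xd) (face_type x6 x7 xe xf)
    + T42_sum (face_type x0 x2 x4 x6) (face_type x1 x3 x5 x7)
        (face_type x8 xa xc xe) (face_type x9 xb xd xf)
    + T42_sum (face_type x0 x2 x8 xa) (face_type x1 x3 x9 xb)
        (face_type x4 x6 xc xe) (face_type x5 x7 xd xf)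
    + T42_sum (face_type x0 x4 x8 xc) (face_type x1 x5 x9 xd)
        (face_type x2 x6 xa xe) (face_type x3 x7 xb xf)"

lemma loc42_symmetric:
  "loc42 x1 x0 x3 x2 x5 x4 x7 x6 x9 x8 xb xa xd xc xf xe = loc42 x0 x1 x2 x3 x4 x5 x6 x7 x8 x9 xa xb xc xd xe xf"
  "loc42 x2 x3 x0 x1 x6 x7 x4 x5 xa xb x8 x9 xe xf xc xd = loc42 x0 x1 x2 x3 x4 x5 x6 x7 x8 x9 xa xb xc xd xe xf"
  "loc42 x4 x5 x6 x7 x0 x1 x2 x3 xc xd xe xf x8 x9 xa xb = loc42 x0 x1 x2 x3 x4 x5 x6 x7 x8 x9 xa xb xc xd xe xf"
  "loc42 x8 x9 xa xb xc xd xe xf x0 x1 x2 x3 x4 x5 x6 x7 = loc42 x0 x1 x2 x3 x4 x5 x6 x7 x8 x9 xa xb xc xd xe xf"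
  "loc42 x0 x2 x1 x3 x4 x6 x5 x7 x8 xa x9 xb xc xe xd xf = loc42 x0 x1 x2 x3 x4 x5 x6 x7 x8 x9 xa xb xc xd xe xf"
  "loc42 x0 x1 x4 x5 x2 x3 x6 x7 x8 x9 xc xd xa xb xe xf = loc42 x0 x1 x2 x3 x4 x5 x6 x7 x8 x9 xa xb xc xd xe xf"
  "loc42 x0 x1 x2 x3 x8 x9 xa xb x4 x5 x6 x7 xc xd xe xf = loc42 x0 x1 x2 x3 x4 x5 x6 x7 x8 x9 xa xb xc xd xe xf"
  by (simp_all only: loc42_def T42_sum_face_type T42_sum_symmetric(1-3) ac_simps)

text \<open>The bounds are 24 * 28512 and 24 * (28512 - 37044), where 28512 / 37044 = 264 / 343. The
  empty 4-cube attains the first, since 28512 = 1782 * 4^2.\<close>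

definition ok42 where
  "ok42 x0 x1 x2 x3 x4 x5 x6 x7 x8 x9 xa xb xc xd xe xf
    \<longleftrightarrow> loc42 x0 x1 x2 x3 x4 x5 x6 x7 x8 x9 xa xb xc xd xe xf
      \<le> (if size16 x0 x1 x2 x3 x4 x5 x6 x7 x8 x9 xa xb xc xd xe xf = 2 then - 204768 else 684288)"

lemma lex_check_ok42: "lex_check ok42"
  by code_simp

lemma ok42: "ok42 x0 x1 x2 x3 x4 x5 x6 x7 x8 x9 xa xb xc xd xe xf"
  by (rule lex_check_complete[OF lex_check_ok42])
     (simp_all only: ok42_def loc42_symmetric size16_symmetric)

subsection \<open>Averaging over subcubes\<close>

text \<open>The vertices come in binary order with \<open>i\<close> as lowest bit, matching the
  variables \<open>x0\<close> to \<open>xf\<close>.\<close>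

definition on_cube4 where
  "on_cube4 P S v i j k l = P
      (v \<in> S) (flip i v \<in> S) (flip j v \<in> S) (flip i (flip j v) \<in> S)
      (flip k v \<in> S) (flip i (flip k v) \<in> S) (flip j (flip k v) \<in> S) (flip i (flip j (flip k v)) \<in> S)
      (flip l v \<in> S) (flip i (flip l v) \<in> S) (flip j (flip l v) \<in> S) (flip i (flip j (flip l v)) \<in> S)
      (flip k (flip l v) \<in> S) (flip i (flip k (flip l v)) \<in> S) (flip j (flip k (flip l v)) \<in> S) (flip i (flip j (flip k (flip l v))) \<in> S)"

lemma cnt_eq_size16: "cnt S v [i, j, k, l] = on_cube4 size16 S v i j k l"
  by (simp add: on_cube4_def size16_def of_bool_def flip_commute)

definition total :: "nat \<Rightarrow> nat \<Rightarrow> (nat set \<Rightarrow> nat list \<Rightarrow> int) \<Rightarrow> int" where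
  "total n d g = (\<Sum>xs\<in>dtuples n d. \<Sum>v\<in>cube n. g v xs)"

definition rearrange :: "nat list \<Rightarrow> (nat set \<Rightarrow> nat list \<Rightarrow> int) \<Rightarrow> nat set \<Rightarrow> nat list \<Rightarrow> int" where
  "rearrange ps g v xs = g v (map ((!) xs) ps)"

definition fold_dir :: "nat \<Rightarrow> (nat set \<Rightarrow> nat list \<Rightarrow> int) \<Rightarrow> nat set \<Rightarrow> nat list \<Rightarrow> int" where
  "fold_dir p g v xs = g v xs + g (flip (xs ! p) v) xs"

lemma total_add: "total n d (\<lambda>v xs. g v xs + g' v xs) = total n d g + total n d g'"
  by (simp add: total_def sum.distrib)

lemma total_rearrange:
  assumes "distinct ps" "set ps = {..<d}"
  shows "total n d (rearrange ps g) = total n d g"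
  unfolding total_def rearrange_def
  using sum_dtuples_permute[OF assms, of "\<lambda>xs. \<Sum>v\<in>cube n. g v xs"] .

text \<open>Flipping a coordinate permutes the cube, so both summands have the same total.\<close>

lemma total_fold_dir:
  assumes "p < d"
  shows "total n d (fold_dir p g) = 2 * total n d g"
proof -
  have "xs ! p < n" if "xs \<in> dtuples n d" for xs
  proof -
    have "length xs = d" "set xs \<subseteq> {..<n}" using that by (auto simp: dtuples_def tuples_def)
    then show ?thesis using assms nth_mem[of p xs] by blast
  qed
  then have "(\<Sum>xs\<in>dtuples n d. \<Sum>v\<in>cube n. g (flip (xs ! p) v) xs) = (\<Sum>xs\<in>dtuples n d. \<Sum>v\<in>cube n. g v xs)"
    by (intro sum.cong[OF refl] sum_cube_flip)
  then show ?thesis by (simp add: total_def fold_dir_def sum.distrib)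
qed

lemma sum_tuples_4:
  "(\<Sum>xs\<in>tuples n 4. \<Sum>v\<in>cube n. g v (xs ! 0) (xs ! 1) (xs ! 2) (xs ! 3))
    = (\<Sum>v\<in>cube n. \<Sum>i<n. \<Sum>j<n. \<Sum>k<n. \<Sum>l<n. g v i j k l)"
  by (simp add: numeral_nat sum_tuples_Suc sum_tuples_0 sum.swap[of _ "cube n"])

lemma dtuples_4E:
  assumes "xs \<in> dtuples n 4"
  obtains i j k l where "xs = [i, j, k, l]"
  using assms by (auto simp: dtuples_def tuples_def numeral_nat length_Suc_conv)

section \<open>The upper bound for lambda(4,2)\<close>

definition term42 :: "nat set set \<Rightarrow> nat set \<Rightarrow> nat \<Rightarrow> nat \<Rightarrow> nat \<Rightarrow> nat \<Rightarrow> int" where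
  "term42 S v i j k l =
    (let F = (\<lambda>v. face_type (v \<in> S) (flip i v \<in> S) (flip j v \<in> S) (flip i (flip j v) \<in> S))
     in T42 (F v) (F (flip k v)) (F (flip l v)))"

lemma term42_sum_nonneg: "(\<Sum>i\<in>I. \<Sum>j\<in>I. \<Sum>k\<in>I. \<Sum>l\<in>I. term42 S v i j k l) \<ge> 0"
  unfolding term42_def Let_def by (rule sum_nonneg, rule sum_nonneg, rule T42_sum_nonneg)

lemma total_loc42:
  fixes S n
  defines "\<tau> \<equiv> \<lambda>v xs. term42 S v (xs ! 0) (xs ! 1) (xs ! 2) (xs ! 3)"
  shows "total n 4 (\<lambda>v xs. on_cube4 loc42 S v (xs ! 0) (xs ! 1) (xs ! 2) (xs ! 3)) = 24 * total n 4 \<tau>"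
proof -
  let ?g = "fold_dir 2 (fold_dir 3 \<tau>)"
  \<comment> \<open>The six orders choose the two face directions, and folding along the other two
    runs through the four parallel faces; hence the factor 6 * 4.\<close>
  have "on_cube4 loc42 S v (xs ! 0) (xs ! 1) (xs ! 2) (xs ! 3)
    = ?g v xs + rearrange [0, 2, 1, 3] ?g v xs + rearrange [0, 3, 1, 2] ?g v xs
      + rearrange [1, 2, 0, 3] ?g v xs + rearrange [1, 3, 0, 2] ?g v xs + rearrange [2, 3, 0, 1] ?g v xs" for v xs
    by (simp add: on_cube4_def loc42_def T42_sum_def rearrange_def fold_dir_def \<tau>_def term42_def Let_def flip_commute)
  moreover have "total n 4 ?g = 4 * total n 4 \<tau>"
    by (simp add: total_fold_dir)
  moreover have "total n 4 (rearrange ps ?g) = total n 4 ?g"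
    if "ps \<in> {[0, 2, 1, 3], [0, 3, 1, 2], [1, 2, 0, 3], [1, 3, 0, 2], [2, 3, 0, 1]}" for ps
    using that by (intro total_rearrange) auto
  ultimately show ?thesis by (simp add: total_add)
qed

lemma Lambda_set_upper_4_2:
  "real (2 ^ 4 * fact 4 * Lambda_set S n 4 2)
    \<le> 2 ^ n * (264 / 343 * card (dtuples n 4) + 312488 / 37044 * (real n ^ 4 - card (dtuples n 4)))"
proof -
  let ?\<psi> = "\<lambda>v xs. term42 S v (xs ! 0) (xs ! 1) (xs ! 2) (xs ! 3)"
  let ?\<Psi> = "\<lambda>v xs. on_cube4 loc42 S v (xs ! 0) (xs ! 1) (xs ! 2) (xs ! 3)"
  have "(\<Sum>xs\<in>tuples n 4. \<Sum>v\<in>cube n. ?\<psi> v xs) \<ge> 0"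
    unfolding sum_tuples_4[of "term42 S"] by (rule sum_nonneg, rule term42_sum_nonneg)
  moreover have "?\<psi> v xs \<le> 312488" for v xs
    by (simp add: term42_def Let_def T42_le)
  moreover have "?\<Psi> v xs \<le> 24 * (28512 - 37044 * of_bool (cnt S v xs = 2))" if "xs \<in> dtuples n 4" for v xs
    using that
  proof (rule dtuples_4E)
    fix i j k l assume xs: "xs = [i, j, k, l]"
    have "on_cube4 loc42 S v i j k l \<le> (if on_cube4 size16 S v i j k l = 2 then - 204768 else 684288)"
      using ok42 by (simp only: on_cube4_def ok42_def)
    moreover have "?\<Psi> v xs = on_cube4 loc42 S v i j k l" by (simp add: xs)
    moreover have "cnt S v xs = on_cube4 size16 S v i j k l" by (simp only: xs cnt_eq_size16)
    ultimately show ?thesis by (simp split: if_splits)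
  qed
  ultimately show ?thesis
    using Lambda_set_upper[where \<psi> = ?\<psi> and \<Psi> = ?\<Psi> and n = n and d = 4 and S = S and s = 2
        and m = 24 and a = 28512 and b = 37044 and K = 312488] total_loc42[of n S]
    by (simp add: total_def)
qed

subsection \<open>The certificate for \<open>\<lambda>(4,4)\<close>\<close>

text \<open>The arguments are the values at \<open>v + i\<close>, \<open>v + j\<close> and \<open>v + i + j\<close>. As before, the weights have mean zero
  in the extremal construction; \<open>w44a\<close> and \<open>w44b\<close> are used for \<open>v \<notin> S\<close>, and \<open>w44c\<close> for \<open>v \<in> S\<close>.\<close>

fun w44a :: "bool \<Rightarrow> bool \<Rightarrow> bool \<Rightarrow> int" where
  "w44a False False False = 52"
| "w44a False False True = - 5"
| "w44a True True False = - 66"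
| "w44a True True True = 0"
| "w44a _ _ False = - 7"
| "w44a _ _ True = - 66"

fun w44b :: "bool \<Rightarrow> bool \<Rightarrow> bool \<Rightarrow> int" where
  "w44b False False False = 0"
| "w44b False False True = - 3"
| "w44b True True False = 2"
| "w44b True True True = 0"
| "w44b _ _ _ = 1"

fun w44c :: "bool \<Rightarrow> bool \<Rightarrow> bool \<Rightarrow> int" where
  "w44c False False False = 1"
| "w44c False False True = - 2"
| "w44c _ _ _ = 0"

fun T44 :: "bool \<Rightarrow> bool \<Rightarrow> bool \<Rightarrow> bool \<Rightarrow> bool \<Rightarrow> bool \<Rightarrow> bool \<Rightarrow> int" where
  "T44 False i j ij k l kl = w44a i j ij * w44a k l kl + 68 * (w44b i j ij * w44b k l kl)"
| "T44 True i j ij k l kl = 195 * (w44c i j ij * w44c k l kl)"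

text \<open>The three terms are the ways to split four directions into two pairs.\<close>

definition T44_sum where
  "T44_sum v i j k l ij ik il jk jl kl = T44 v i j ij k l kl + T44 v i k ik j l jl + T44 v i l il j k jk"

lemma w44_commute: "w44a j i ij = w44a i j ij" "w44b j i ij = w44b i j ij" "w44c j i ij = w44c i j ij"
  by (cases i; cases j; cases ij; simp)+

lemma T44_symmetric:
  "T44 v j i ij k l kl = T44 v i j ij k l kl"
  "T44 v i j ij l k kl = T44 v i j ij k l kl"
  "T44 v k l kl i j ij = T44 v i j ij k l kl"
  by (cases v; simp add: w44_commute[of i j] w44_commute[of k l])+

lemma T44_le: "T44 v i j ij k l kl \<le> 5000"
  by (cases v; cases i; cases j; cases ij; cases k; cases l; cases kl; simp)

lemma T44_sum_symmetric:
  "T44_sum v j i k l ij jk jl ik il kl = T44_sum v i j k l ij ik il jk jl kl"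
  "T44_sum v i k j l ik ij il jk kl jl = T44_sum v i j k l ij ik il jk jl kl"
  "T44_sum v i j l k ij il ik jl jk kl = T44_sum v i j k l ij ik il jk jl kl"
  unfolding T44_sum_def using T44_symmetric by smt+

text \<open>Each of the 16 vertices serves as base point, which gives 48 terms.\<close>

definition loc44 where
  "loc44 x0 x1 x2 x3 x4 x5 x6 x7 x8 x9 xa xb xc xd xe xf =
      T44_sum x0 x1 x2 x4 x8 x3 x5 x9 x6 xa xc
    + T44_sum x1 x0 x3 x5 x9 x2 x4 x8 x7 xb xd
    + T44_sum x2 x3 x0 x6 xa x1 x7 xb x4 x8 xe
    + T44_sum x3 x2 x1 x7 xb x0 x6 xa x5 x9 xf
    + T44_sum x4 x5 x6 x0 xc x7 x1 xd x2 xe x8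
    + T44_sum x5 x4 x7 x1 xd x6 x0 xc x3 xf x9
    + T44_sum x6 x7 x4 x2 xe x5 x3 xf x0 xc xa
    + T44_sum x7 x6 x5 x3 xf x4 x2 xe x1 xd xb
    + T44_sum x8 x9 xa xc x0 xb xd x1 xe x2 x4
    + T44_sum x9 x8 xb xd x1 xa xc x0 xf x3 x5
    + T44_sum xa xb x8 xe x2 x9 xf x3 xc x0 x6
    + T44_sum xb xa x9 xf x3 x8 xe x2 xd x1 x7
    + T44_sum xc xd xe x8 x4 xf x9 x5 xa x6 x0
    + T44_sum xd xc xf x9 x5 xe x8 x4 xb x7 x1
    + T44_sum xe xf xc xa x6 xd xb x7 x8 x4 x2
    + T44_sum xf xe xd xb x7 xc xa x6 x9 x5 x3"

lemma loc44_symmetric: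
  "loc44 x1 x0 x3 x2 x5 x4 x7 x6 x9 x8 xb xa xd xc xf xe = loc44 x0 x1 x2 x3 x4 x5 x6 x7 x8 x9 xa xb xc xd xe xf"
  "loc44 x2 x3 x0 x1 x6 x7 x4 x5 xa xb x8 x9 xe xf xc xd = loc44 x0 x1 x2 x3 x4 x5 x6 x7 x8 x9 xa xb xc xd xe xf"
  "loc44 x4 x5 x6 x7 x0 x1 x2 x3 xc xd xe xf x8 x9 xa xb = loc44 x0 x1 x2 x3 x4 x5 x6 x7 x8 x9 xa xb xc xd xe xf"
  "loc44 x8 x9 xa xb xc xd xe xf x0 x1 x2 x3 x4 x5 x6 x7 = loc44 x0 x1 x2 x3 x4 x5 x6 x7 x8 x9 xa xb xc xd xe xf"
  "loc44 x0 x2 x1 x3 x4 x6 x5 x7 x8 xa x9 xb xc xe xd xf = loc44 x0 x1 x2 x3 x4 x5 x6 x7 x8 x9 xa xb xc xd xe xf"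
  "loc44 x0 x1 x4 x5 x2 x3 x6 x7 x8 x9 xc xd xa xb xe xf = loc44 x0 x1 x2 x3 x4 x5 x6 x7 x8 x9 xa xb xc xd xe xf"
  "loc44 x0 x1 x2 x3 x8 x9 xa xb x4 x5 x6 x7 xc xd xe xf = loc44 x0 x1 x2 x3 x4 x5 x6 x7 x8 x9 xa xb xc xd xe xf"
  by (simp_all only: loc44_def T44_sum_symmetric ac_simps)

text \<open>The bounds are 48 * 2704 and 48 * (2704 - 2808), where 2704 / 2808 = 26 / 27. The empty
  4-cube attains the first, since 2704 = 52^2.\<close>

definition ok44 where
  "ok44 x0 x1 x2 x3 x4 x5 x6 x7 x8 x9 xa xb xc xd xe xf
    \<longleftrightarrow> loc44 x0 x1 x2 x3 x4 x5 x6 x7 x8 x9 xa xb xc xd xe xf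
      \<le> (if size16 x0 x1 x2 x3 x4 x5 x6 x7 x8 x9 xa xb xc xd xe xf = 4 then - 4992 else 129792)"

lemma lex_check_ok44: "lex_check ok44"
  by code_simp

lemma ok44: "ok44 x0 x1 x2 x3 x4 x5 x6 x7 x8 x9 xa xb xc xd xe xf"
  by (rule lex_check_complete[OF lex_check_ok44])
     (simp_all only: ok44_def loc44_symmetric size16_symmetric)

section \<open>The upper bound for lambda(4,4)\<close>

definition term44 :: "nat set set \<Rightarrow> nat set \<Rightarrow> nat \<Rightarrow> nat \<Rightarrow> nat \<Rightarrow> nat \<Rightarrow> int" where
  "term44 S v i j k l = T44 (v \<in> S) (flip i v \<in> S) (flip j v \<in> S) (flip i (flip j v) \<in> S)
    (flip k v \<in> S) (flip l v \<in> S) (flip k (flip l v) \<in> S)"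

text \<open>With only \<open>v\<close> fixed, the pairs (i, j) and (k, l) vary independently, so
  each product of weights sums to the square of a sum over pairs.\<close>

lemma term44_sum_nonneg:
  "(\<Sum>i\<in>I. \<Sum>j\<in>I. \<Sum>k\<in>I. \<Sum>l\<in>I. term44 S v i j k l) \<ge> 0"
  by (cases "v \<in> S")
     (simp_all add: term44_def sum.distrib flip: sum_distrib_left sum_distrib_right)

lemma total_loc44:
  fixes S n
  defines "\<tau> \<equiv> \<lambda>v xs. term44 S v (xs ! 0) (xs ! 1) (xs ! 2) (xs ! 3)"
  shows "total n 4 (\<lambda>v xs. on_cube4 loc44 S v (xs ! 0) (xs ! 1) (xs ! 2) (xs ! 3)) = 48 * total n 4 \<tau>"
proof -
  define g where "g = (\<lambda>v xs. \<tau> v xs + rearrange [0, 2, 1, 3] \<tau> v xs + rearrange [0, 3, 1, 2] \<tau> v xs)"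
  have g_eq: "g v xs = T44_sum (v \<in> S) (flip (xs ! 0) v \<in> S) (flip (xs ! 1) v \<in> S) (flip (xs ! 2) v \<in> S) (flip (xs ! 3) v \<in> S)
      (flip (xs ! 0) (flip (xs ! 1) v) \<in> S) (flip (xs ! 0) (flip (xs ! 2) v) \<in> S) (flip (xs ! 0) (flip (xs ! 3) v) \<in> S)
      (flip (xs ! 1) (flip (xs ! 2) v) \<in> S) (flip (xs ! 1) (flip (xs ! 3) v) \<in> S) (flip (xs ! 2) (flip (xs ! 3) v) \<in> S)" for v xs
    by (simp add: g_def rearrange_def \<tau>_def term44_def T44_sum_def)
  \<comment> \<open>Folding along all four directions moves the base point through the 16 vertices;
    with the three pairings in \<open>g\<close> the factor is 16 * 3.\<close>
  have "on_cube4 loc44 S v (xs ! 0) (xs ! 1) (xs ! 2) (xs ! 3)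
    = fold_dir 0 (fold_dir 1 (fold_dir 2 (fold_dir 3 g))) v xs" for v xs
    by (simp only: on_cube4_def loc44_def fold_dir_def g_eq flip_flip flip_commute ac_simps)
  moreover have "total n 4 (rearrange ps \<tau>) = total n 4 \<tau>" if "ps \<in> {[0, 2, 1, 3], [0, 3, 1, 2]}" for ps
    using that by (intro total_rearrange) auto
  then have "total n 4 g = 3 * total n 4 \<tau>"
    by (simp add: g_def total_add)
  ultimately show ?thesis by (simp add: total_fold_dir)
qed

lemma Lambda_set_upper_4_4:
  "real (2 ^ 4 * fact 4 * Lambda_set S n 4 4)
    \<le> 2 ^ n * (26 / 27 * card (dtuples n 4) + 5000 / 2808 * (real n ^ 4 - card (dtuples n 4)))"
proof -
  let ?\<psi> = "\<lambda>v xs. term44 S v (xs ! 0) (xs ! 1) (xs ! 2) (xs ! 3)"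
  let ?\<Psi> = "\<lambda>v xs. on_cube4 loc44 S v (xs ! 0) (xs ! 1) (xs ! 2) (xs ! 3)"
  have "(\<Sum>xs\<in>tuples n 4. \<Sum>v\<in>cube n. ?\<psi> v xs) \<ge> 0"
    unfolding sum_tuples_4[of "term44 S"] by (rule sum_nonneg, rule term44_sum_nonneg)
  moreover have "?\<psi> v xs \<le> 5000" for v xs
    by (simp add: term44_def T44_le)
  moreover have "?\<Psi> v xs \<le> 48 * (2704 - 2808 * of_bool (cnt S v xs = 4))" if "xs \<in> dtuples n 4" for v xs
    using that
  proof (rule dtuples_4E)
    fix i j k l assume xs: "xs = [i, j, k, l]"
    have "on_cube4 loc44 S v i j k l \<le> (if on_cube4 size16 S v i j k l = 4 then - 4992 else 129792)"
      using ok44 by (simp only: on_cube4_def ok44_def)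
    moreover have "?\<Psi> v xs = on_cube4 loc44 S v i j k l" by (simp add: xs)
    moreover have "cnt S v xs = on_cube4 size16 S v i j k l" by (simp only: xs cnt_eq_size16)
    ultimately show ?thesis by (simp split: if_splits)
  qed
  ultimately show ?thesis
    using Lambda_set_upper[where \<psi> = ?\<psi> and \<Psi> = ?\<Psi> and n = n and d = 4 and S = S and s = 4
        and m = 48 and a = 2704 and b = 2808 and K = 5000] total_loc44[of n S]
    by (simp add: total_def)
qed

subsection \<open>The certificate for \<open>\<lambda>(3,2)\<close>\<close>

text \<open>These weights of a parallel neighbouring edge have mean zero in the extremal
  construction: \<open>w32a\<close> and \<open>w32b\<close> for an empty base edge,
  \<open>w32c\<close> for one with only its first endpoint in \<open>S\<close>.\<close>

fun w32a :: "bool \<Rightarrow> bool \<Rightarrow> int" where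
  "w32a False False = 2" | "w32a True True = 0" | "w32a _ _ = - 1"

fun w32b :: "bool \<Rightarrow> bool \<Rightarrow> int" where
  "w32b True False = 1" | "w32b False True = - 1" | "w32b _ _ = 0"

fun w32c :: "bool \<Rightarrow> bool \<Rightarrow> int" where
  "w32c False False = 1" | "w32c True False = - 1" | "w32c False True = - 2" | "w32c True True = 0"

text \<open>An edge with only its second endpoint in \<open>S\<close> is treated as the mirror
  image. A full edge, absent from the construction, gets zero.\<close>

fun T32 :: "bool \<Rightarrow> bool \<Rightarrow> bool \<Rightarrow> bool \<Rightarrow> bool \<Rightarrow> bool \<Rightarrow> int" where
  "T32 False False a a' b b' = 2 * (w32a a a' * w32a b b') + 6 * (w32b a a' * w32b b b')"
| "T32 True False a a' b b' = 2 * (w32c a a' * w32c b b')"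
| "T32 False True a a' b b' = 2 * (w32c a' a * w32c b' b)"
| "T32 True True a a' b b' = 0"

lemma T32_le: "T32 p p' a a' b b' \<le> 100"
  by (cases p; cases p'; cases a; cases a'; cases b; cases b'; simp)

lemma T32_sum_nonneg: "(\<Sum>j\<in>I. \<Sum>k\<in>I. T32 p p' (a j) (a' j) (a k) (a' k)) \<ge> 0"
  by (cases p; cases p')
     (simp_all add: sum.distrib sum_sum_product_nonneg flip: sum_distrib_left)

definition loc32 where
  "loc32 x0 x1 x2 x3 x4 x5 x6 x7 =
      T32 x0 x1 x2 x3 x4 x5 + T32 x2 x3 x0 x1 x6 x7 + T32 x4 x5 x6 x7 x0 x1 + T32 x6 x7 x4 x5 x2 x3
    + T32 x0 x2 x1 x3 x4 x6 + T32 x1 x3 x0 x2 x5 x7 + T32 x4 x6 x5 x7 x0 x2 + T32 x5 x7 x4 x6 x1 x3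
    + T32 x0 x4 x1 x5 x2 x6 + T32 x1 x5 x0 x4 x3 x7 + T32 x2 x6 x3 x7 x0 x4 + T32 x3 x7 x2 x6 x1 x5"

definition size8 :: "bool \<Rightarrow> bool \<Rightarrow> bool \<Rightarrow> bool \<Rightarrow> bool \<Rightarrow> bool \<Rightarrow> bool \<Rightarrow> bool \<Rightarrow> nat" where
  "size8 x0 x1 x2 x3 x4 x5 x6 x7
    = of_bool x0 + of_bool x1 + of_bool x2 + of_bool x3
      + of_bool x4 + of_bool x5 + of_bool x6 + of_bool x7"

text \<open>A 3-cube has only 256 subsets, so all are evaluated directly. The bounds are 12 * 8 and
  12 * (8 - 9), one multiple for each of the 12 edges.\<close>

lemma loc32_le:
  "\<forall>x0 x1 x2 x3 x4 x5 x6 x7. loc32 x0 x1 x2 x3 x4 x5 x6 x7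
    \<le> (if size8 x0 x1 x2 x3 x4 x5 x6 x7 = 2 then - 12 else 96)"
  by code_simp

section \<open>The upper bound for lambda(3,2)\<close>

definition on_cube3 where
  "on_cube3 P S v i j k = P
      (v \<in> S) (flip i v \<in> S) (flip j v \<in> S) (flip i (flip j v) \<in> S)
      (flip k v \<in> S) (flip i (flip k v) \<in> S) (flip j (flip k v) \<in> S) (flip i (flip j (flip k v)) \<in> S)"

lemma cnt_eq_size8: "cnt S v [i, j, k] = on_cube3 size8 S v i j k"
  by (simp add: on_cube3_def size8_def of_bool_def flip_commute)

lemma sum_tuples_3:
  "(\<Sum>xs\<in>tuples n 3. \<Sum>v\<in>cube n. g v (xs ! 0) (xs ! 1) (xs ! 2))
    = (\<Sum>v\<in>cube n. \<Sum>i<n. \<Sum>j<n. \<Sum>k<n. g v i j k)"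
  by (simp add: numeral_nat sum_tuples_Suc sum_tuples_0 sum.swap[of _ "cube n"])

lemma dtuples_3E:
  assumes "xs \<in> dtuples n 3"
  obtains i j k where "xs = [i, j, k]"
  using assms by (auto simp: dtuples_def tuples_def numeral_nat length_Suc_conv)

definition term32 :: "nat set set \<Rightarrow> nat set \<Rightarrow> nat \<Rightarrow> nat \<Rightarrow> nat \<Rightarrow> int" where
  "term32 S v i j k = T32 (v \<in> S) (flip i v \<in> S) (flip j v \<in> S) (flip i (flip j v) \<in> S)
    (flip k v \<in> S) (flip i (flip k v) \<in> S)"

lemma term32_sum_nonneg: "(\<Sum>i\<in>I. \<Sum>j\<in>I. \<Sum>k\<in>I. term32 S v i j k) \<ge> 0"
  unfolding term32_def by (rule sum_nonneg, rule T32_sum_nonneg)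

lemma total_loc32:
  fixes S n
  defines "\<tau> \<equiv> \<lambda>v xs. term32 S v (xs ! 0) (xs ! 1) (xs ! 2)"
  shows "total n 3 (\<lambda>v xs. on_cube3 loc32 S v (xs ! 0) (xs ! 1) (xs ! 2)) = 12 * total n 3 \<tau>"
proof -
  let ?g = "fold_dir 1 (fold_dir 2 \<tau>)"
  \<comment> \<open>Three choices of the edge direction and four parallel edges give the factor
    12.\<close>
  have "on_cube3 loc32 S v (xs ! 0) (xs ! 1) (xs ! 2)
    = ?g v xs + rearrange [1, 0, 2] ?g v xs + rearrange [2, 0, 1] ?g v xs" for v xs
    by (simp add: on_cube3_def loc32_def rearrange_def fold_dir_def \<tau>_def term32_def flip_commute)
  moreover have "total n 3 ?g = 4 * total n 3 \<tau>"
    by (simp add: total_fold_dir)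
  moreover have "total n 3 (rearrange ps ?g) = total n 3 ?g" if "ps \<in> {[1, 0, 2], [2, 0, 1]}" for ps
    using that by (intro total_rearrange) auto
  ultimately show ?thesis by (simp add: total_add)
qed

lemma Lambda_set_upper_3_2:
  "real (2 ^ 3 * fact 3 * Lambda_set S n 3 2)
    \<le> 2 ^ n * (8 / 9 * card (dtuples n 3) + 100 / 9 * (real n ^ 3 - card (dtuples n 3)))"
proof -
  let ?\<psi> = "\<lambda>v xs. term32 S v (xs ! 0) (xs ! 1) (xs ! 2)"
  let ?\<Psi> = "\<lambda>v xs. on_cube3 loc32 S v (xs ! 0) (xs ! 1) (xs ! 2)"
  have "(\<Sum>xs\<in>tuples n 3. \<Sum>v\<in>cube n. ?\<psi> v xs) \<ge> 0"
    unfolding sum_tuples_3[of "term32 S"] by (rule sum_nonneg, rule term32_sum_nonneg)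
  moreover have "?\<psi> v xs \<le> 100" for v xs
    by (simp add: term32_def T32_le)
  moreover have "?\<Psi> v xs \<le> 12 * (8 - 9 * of_bool (cnt S v xs = 2))" if "xs \<in> dtuples n 3" for v xs
    using that
  proof (rule dtuples_3E)
    fix i j k assume xs: "xs = [i, j, k]"
    have "on_cube3 loc32 S v i j k \<le> (if on_cube3 size8 S v i j k = 2 then - 12 else 96)"
      using loc32_le by (simp only: on_cube3_def)
    moreover have "?\<Psi> v xs = on_cube3 loc32 S v i j k" by (simp add: xs)
    moreover have "cnt S v xs = on_cube3 size8 S v i j k" by (simp only: xs cnt_eq_size8)
    ultimately show ?thesis by (simp split: if_splits)
  qed
  ultimately show ?thesis
    using Lambda_set_upper[where \<psi> = ?\<psi> and \<Psi> = ?\<Psi> and n = n and d = 3 and S = S and s = 2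
        and m = 12 and a = 8 and b = 9 and K = 100] total_loc32[of n S]
    by (simp add: total_def)
qed

section \<open>Combining the bounds\<close>

lemma linear_set_subset: "linear_set w n \<subseteq> cube n"
  by (auto simp: linear_set_def)

theorem theorem1p3:
  shows "Lambda_ratio 3 2 \<longlonglongrightarrow> 8 / 9 \<and>
         Lambda_ratio 4 2 \<longlonglongrightarrow> 264 / 343 \<and>
         Lambda_ratio 4 4 \<longlonglongrightarrow> 26 / 27"
proof (intro conjI)
  show "Lambda_ratio 3 2 \<longlonglongrightarrow> 8 / 9"
    \<comment> \<open>The limits are the proportions of spanning tuples: 24 / 3^3, then 1848 / 7^4
      and 78 / 3^4.\<close>
    using linear_lower_asymp[of 3 24 3]
    by (intro Lambda_ratio_tendstoI[OF Lambda_set_upper_3_2 linear_set_subset Lambda_set_lower_3[OF spanning_count_3_2]]) simp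
  show "Lambda_ratio 4 2 \<longlonglongrightarrow> 264 / 343"
    using linear_lower_asymp[of 7 1848 4]
    by (intro Lambda_ratio_tendstoI[OF Lambda_set_upper_4_2 linear_set_subset Lambda_set_lower_7[OF spanning_count_7_2]]) simp
  show "Lambda_ratio 4 4 \<longlonglongrightarrow> 26 / 27"
    using linear_lower_asymp[of 3 78 4]
    by (intro Lambda_ratio_tendstoI[OF Lambda_set_upper_4_4 linear_set_subset Lambda_set_lower_3[OF spanning_count_3_4]]) simp
qed

end
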